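(* Let $t$ be the data vector of a PGCS equation $A_kX_k-Y_kB_k=E_k$, $C_kX_{k+1}-Y_kD_k=F_k$ ($k=1,\dots,p$, $X_{p+1}=X_1$) whose coefficient matrix $W$ is nonsingular, let $X_k,Y_k\in\mathbb R^{m\times n}$ ($k=1,\dots,p$) be its solution, and assume $[X_1,Y_1,\dots,X_p,Y_p]\ne0$. Let $\Psi:t\mapsto z=\mathrm{vec}([X_1,Y_1,\dots,X_p,Y_p])$ be the solution map. Then the mixed and componentwise condition numbers of the PGCS equation are $$m(\Psi,t)=\frac{\big\||W^{-1}H_2|\,|t|\big\|_\infty}{\|[X_1,Y_1,\dots,X_p,Y_p]\|_{\max}}=\frac{\|\omega\|_\infty}{\|[X_1,Y_1,\dots,X_p,Y_p]\|_{\max}},$$ $$c(\Psi,t)=\left\|\frac{|W^{-1}H_2|\,|t|}{\mathrm{vec}([X_1,Y_1,\dots,X_p,Y_p])}\right\|_\infty=\left\|\frac{\omega}{\mathrm{vec}([X_1,Y_1,\dots,X_p,Y_p])}\right\|_\infty,$$ where $$\omega=\sum_{k=1}^p\Big(|W^{-1}P_{2k-1}(X_k^T\otimes I)|\,|\mathrm{vec}(A_k)|+|W^{-1}P_{2k-1}(I\otimes Y_k)|\,|\mathrm{vec}(B_k)|+|W^{-1}P_{2k-1}|\,|\mathrm{vec}(E_k)|$$ $$\qquad+|W^{-1}P_{2k}(X_{k+1}^T\otimes I)|\,|\mathrm{vec}(C_k)|+|W^{-1}P_{2k}(I\otimes Y_k)|\,|\mathrm{vec}(D_k)|+|W^{-1}P_{2k}|\,|\mathrm{vec}(F_k)|\Big),$$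 and $P_j\in\mathbb R^{2pmn\times mn}$ denotes the $j$-th block column (of width $mn$) of the identity matrix of order $2pmn$, $j=1,\dots,2p$.
   Context: Setting: $p,m,n\ge1$ are integers; $A_k,C_k\in\mathbb R^{m\times m}$, $B_k,D_k\in\mathbb R^{n\times n}$, $E_k,F_k\in\mathbb R^{m\times n}$ ($k=1,\dots,p$). $\otimes$ is the Kronecker product, $\mathrm{vec}$ stacks the columns of a matrix one underneath the other, $I$ is an identity matrix of appropriate order, $|M|=(|m_{ij}|)$ is the entrywise absolute value, $\|\cdot\|_\infty$ is the max norm for vectors, and $\|M\|_{\max}=\|\mathrm{vec}(M)\|_\infty$. The PGCS equation is equivalent to $Wz=g$ with $z=\mathrm{vec}([X_1,Y_1,\dots,X_p,Y_p])$, $g=\mathrm{vec}([E_1,F_1,\dots,E_p,F_p])$, where $W\in\mathbb R^{2pmn\times 2pmn}$ is the matrix of the linear map sending $\mathrm{vec}([X_1,Y_1,\dots,X_p,Y_p])$ to $\mathrm{vec}([A_1X_1-Y_1B_1,\ C_1X_2-Y_1D_1,\ \dots,\ A_pX_p-Y_pB_p,\ C_pX_1-Y_pD_p])$. That is, in $mn\times mn$ blocks, block row $2k-1$ has $I\otimes A_k$ in the column of $X_k$ and $-(B_k^T\otimes I)$ in the column of $Y_k$; block row $2k$ has $-(D_k^T\otimes I)$ in the column of $Y_k$ and $I\otimes C_k$ in the column of $X_{k+1}$ (with $X_{p+1}=X_1$); all other blocks are zero. The data vector is $t\in\mathbb R^{2p(m^2+n^2+mn)}$ obtained by stacking, for $k=1,\dots,p$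 in order, $\mathrm{vec}(A_k),\mathrm{vec}(B_k),\mathrm{vec}(E_k),\mathrm{vec}(C_k),\mathrm{vec}(D_k),\mathrm{vec}(F_k)$. The map $\Psi$ is defined on the open set of data vectors for which $W$ is nonsingular and sends $t$ to the unique solution $z$ of $Wz=g$. $H_2=\mathrm{diag}(H_{2,1},\dots,H_{2,p})$ is block diagonal with $$H_{2,k}=\begin{bmatrix}X_k^T\otimes I&-(I\otimes Y_k)&-I&0&0&0\\0&0&0&X_{k+1}^T\otimes I&-(I\otimes Y_k)&-I\end{bmatrix}.$$ Entrywise division: for vectors $a,b\in\mathbb R^{q}$, $a/b=c$ with $c_i=a_i/b_i$ if $b_i\ne0$ and $c_i=a_i$ if $b_i=0$. Componentwise distance: $d(a,b)=\|(a-b)/b\|_\infty$ (with this division convention, so an index with $b_i=0$ contributes $|a_i|$). For $a\in\mathbb R^q$ and $\epsilon>0$, $B^0(a,\epsilon)=\{x\in\mathbb R^q: |x_i-a_i|\le\epsilon|a_i|,\ i=1,\dots,q\}$. For a continuous map $F:\mathrm{Dom}(F)\to\mathbb R^{s}$ on an open set $\mathrm{Dom}(F)\subset\mathbb R^q$ with $0\notin\mathrm{Dom}(F)$, and $a\in\mathrm{Dom}(F)$ with $F(a)\ne0$, the mixed and componentwise condition numbers of $F$ at $a$ are $$m(F,a)=\lim_{\epsilon\to0}\ \sup_{x\in B^0(a,\epsilon),\,x\ne a}\frac{\|F(x)-F(a)\|_\infty}{\|F(a)\|_\infty}\,\frac1{d(x,a)},\qquad c(F,a)=\lim_{\epsilon\to0}\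 \sup_{x\in B^0(a,\epsilon),\,x\ne a}\frac{d(F(x),F(a))}{d(x,a)}.$$ *)

theory Defs
  imports
    "HOL-Library.Extended_Real"
    "Jordan_Normal_Form.Gauss_Jordan_Elimination"
begin

section \<open>Kronecker product, vec, norms\<close>

definition kron :: "real mat \<Rightarrow> real mat \<Rightarrow> real mat" (infixl \<open>\<otimes>\<^sub>K\<close> 70) where
  "A \<otimes>\<^sub>K B = mat (dim_row A * dim_row B) (dim_col A * dim_col B)
     (\<lambda>(i, j). A $$ (i div dim_row B, j div dim_col B) * B $$ (i mod dim_row B, j mod dim_col B))"

text \<open>Columns are stacked one underneath the other; \<open>vec\<close> itself is the library's
  constructor of vectors.\<close>

definition stack_cols :: "real mat \<Rightarrow> real vec" where
  "stack_cols M = vec_of_list (concat (map list_of_vec (cols M)))"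

definition abs_mat :: "real mat \<Rightarrow> real mat" where
  "abs_mat M = map_mat abs M"

definition abs_vec :: "real vec \<Rightarrow> real vec" where
  "abs_vec v = map_vec abs v"

definition norm_inf :: "real vec \<Rightarrow> real" where
  "norm_inf v = Max (insert 0 {\<bar>v $ i\<bar> | i. i < dim_vec v})"

definition norm_max :: "real mat \<Rightarrow> real" where
  "norm_max M = norm_inf (stack_cols M)"

text \<open>Horizontal concatenation of matrices with \<open>r\<close> rows each.\<close>

definition hcat :: "nat \<Rightarrow> real mat list \<Rightarrow> real mat" where
  "hcat r Ms = mat_of_cols r (concat (map cols Ms))"

text \<open>The inverse of a nonsingular matrix (unspecified for singular ones).\<close>

definition inv_mat :: "real mat \<Rightarrow> real mat" where
  "inv_mat M = the (mat_inverse M)"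


section \<open>Mixed and componentwise condition numbers\<close>

definition entry_div :: "real vec \<Rightarrow> real vec \<Rightarrow> real vec" where
  "entry_div a b = vec (dim_vec b) (\<lambda>i. if b $ i \<noteq> 0 then a $ i / b $ i else a $ i)"

definition cdist :: "real vec \<Rightarrow> real vec \<Rightarrow> real" where
  "cdist a b = norm_inf (entry_div (a - b) b)"

definition B0 :: "real vec \<Rightarrow> real \<Rightarrow> real vec set" where
  "B0 a \<epsilon> = {x \<in> carrier_vec (dim_vec a). \<forall>i < dim_vec a. \<bar>x $ i - a $ i\<bar> \<le> \<epsilon> * \<bar>a $ i\<bar>}"

text \<open>The domain \<open>D\<close> of the map is an explicit argument, and the supremum ranges over the points of
  \<open>B0 a \<epsilon>\<close> at which \<open>F\<close> is defined; for \<open>D\<close> open around \<open>a\<close> this is all of \<open>B0 a \<epsilon>\<close>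
  once \<open>\<epsilon>\<close> is small. Suprema and limits are taken in the extended reals, where
  the supremum always makes sense; being monotone in \<open>\<epsilon>\<close>, it always has a
  limit as \<open>\<epsilon>\<close> tends to 0 from the right.\<close>

definition mixed_cond :: "real vec set \<Rightarrow> (real vec \<Rightarrow> real vec) \<Rightarrow> real vec \<Rightarrow> ereal" where
  "mixed_cond D F a = Lim (at_right 0) (\<lambda>\<epsilon>.
     SUP x \<in> {x \<in> B0 a \<epsilon> \<inter> D. x \<noteq> a}.
       ereal (norm_inf (F x - F a) / norm_inf (F a) * (1 / cdist x a)))"

definition comp_cond :: "real vec set \<Rightarrow> (real vec \<Rightarrow> real vec) \<Rightarrow> real vec \<Rightarrow> ereal" where
  "comp_cond D F a = Lim (at_right 0) (\<lambda>\<epsilon>.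
     SUP x \<in> {x \<in> B0 a \<epsilon> \<inter> D. x \<noteq> a}.
       ereal (cdist (F x) (F a) / cdist x a))"


section \<open>The PGCS equation\<close>

text \<open>Families of matrices are indexed by \<open>k = 1, \<dots>, p\<close>; values at other indices are never used.
  The cyclic successor of \<open>k\<close> (with \<open>p + 1\<close> read as \<open>1\<close>) is \<open>k mod p + 1\<close>.\<close>

definition pgcs_coeffs :: "nat \<Rightarrow> nat \<Rightarrow> nat \<Rightarrow>
    (nat \<Rightarrow> real mat) \<Rightarrow> (nat \<Rightarrow> real mat) \<Rightarrow> (nat \<Rightarrow> real mat) \<Rightarrow>
    (nat \<Rightarrow> real mat) \<Rightarrow> (nat \<Rightarrow> real mat) \<Rightarrow> (nat \<Rightarrow> real mat) \<Rightarrow> bool" where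
  "pgcs_coeffs p m n A B C D E F \<longleftrightarrow> (\<forall>k \<in> {1..p}.
     A k \<in> carrier_mat m m \<and> C k \<in> carrier_mat m m \<and>
     B k \<in> carrier_mat n n \<and> D k \<in> carrier_mat n n \<and>
     E k \<in> carrier_mat m n \<and> F k \<in> carrier_mat m n)"

definition pgcs_equation :: "nat \<Rightarrow>
    (nat \<Rightarrow> real mat) \<Rightarrow> (nat \<Rightarrow> real mat) \<Rightarrow> (nat \<Rightarrow> real mat) \<Rightarrow>
    (nat \<Rightarrow> real mat) \<Rightarrow> (nat \<Rightarrow> real mat) \<Rightarrow> (nat \<Rightarrow> real mat) \<Rightarrow>
    (nat \<Rightarrow> real mat) \<Rightarrow> (nat \<Rightarrow> real mat) \<Rightarrow> bool" where
  "pgcs_equation p A B C D E F X Y \<longleftrightarrow> (\<forall>k \<in> {1..p}.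
     A k * X k - Y k * B k = E k \<and> C k * X (k mod p + 1) - Y k * D k = F k)"

text \<open>The \<open>m \<times> 2pn\<close> matrix \<open>[X\<^sub>1, Y\<^sub>1, \<dots>, X\<^sub>p, Y\<^sub>p]\<close>.\<close>

definition interleave :: "nat \<Rightarrow> nat \<Rightarrow> (nat \<Rightarrow> real mat) \<Rightarrow> (nat \<Rightarrow> real mat) \<Rightarrow> real mat" where
  "interleave p m X Y = hcat m (concat (map (\<lambda>k. [X k, Y k]) [1..<Suc p]))"

text \<open>The \<open>mn \<times> mn\<close> block of \<open>W\<close> in block row \<open>r\<close> and block column \<open>s\<close>, both counted from 1:
  block column \<open>2k - 1\<close> belongs to \<open>X\<^sub>k\<close> and block column \<open>2k\<close> to \<open>Y\<^sub>k\<close>.\<close>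

definition W_block :: "nat \<Rightarrow> nat \<Rightarrow> nat \<Rightarrow>
    (nat \<Rightarrow> real mat) \<Rightarrow> (nat \<Rightarrow> real mat) \<Rightarrow> (nat \<Rightarrow> real mat) \<Rightarrow> (nat \<Rightarrow> real mat) \<Rightarrow>
    nat \<Rightarrow> nat \<Rightarrow> real mat" where
  "W_block p m n A B C D r s = (let k = (r + 1) div 2 in
     if r = 2 * k - 1 then
       (if s = 2 * k - 1 then 1\<^sub>m n \<otimes>\<^sub>K A k
        else if s = 2 * k then - (transpose_mat (B k) \<otimes>\<^sub>K 1\<^sub>m m)
        else 0\<^sub>m (m * n) (m * n))
     else
       (if s = 2 * k then - (transpose_mat (D k) \<otimes>\<^sub>K 1\<^sub>m m)
        else if s = 2 * (k mod p + 1) - 1 then 1\<^sub>m n \<otimes>\<^sub>K C k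
        else 0\<^sub>m (m * n) (m * n)))"

definition W_mat :: "nat \<Rightarrow> nat \<Rightarrow> nat \<Rightarrow>
    (nat \<Rightarrow> real mat) \<Rightarrow> (nat \<Rightarrow> real mat) \<Rightarrow> (nat \<Rightarrow> real mat) \<Rightarrow> (nat \<Rightarrow> real mat) \<Rightarrow>
    real mat" where
  "W_mat p m n A B C D = mat (2 * p * m * n) (2 * p * m * n)
     (\<lambda>(i, j). W_block p m n A B C D (i div (m * n) + 1) (j div (m * n) + 1)
                 $$ (i mod (m * n), j mod (m * n)))"

definition data_vec :: "nat \<Rightarrow>
    (nat \<Rightarrow> real mat) \<Rightarrow> (nat \<Rightarrow> real mat) \<Rightarrow> (nat \<Rightarrow> real mat) \<Rightarrow>
    (nat \<Rightarrow> real mat) \<Rightarrow> (nat \<Rightarrow> real mat) \<Rightarrow> (nat \<Rightarrow> real mat) \<Rightarrow> real vec" where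
  "data_vec p A B C D E F = vec_of_list (concat (map (\<lambda>k. concat (map (\<lambda>M. list_of_vec (stack_cols M))
     [A k, B k, E k, C k, D k, F k])) [1..<Suc p]))"

text \<open>\<open>data_vec\<close> determines the coefficients of indices \<open>1, \<dots>, p\<close>, so that the
  matrix \<open>W\<close> and the right-hand side belonging to a data vector are well defined, and the
  description in \<open>\<Psi>\<close> singles out exactly one vector for every \<open>t\<close> in \<open>Dom\<^sub>\<Psi>\<close>.\<close>

definition Dom_Psi :: "nat \<Rightarrow> nat \<Rightarrow> nat \<Rightarrow> real vec set" (\<open>Dom\<^sub>\<Psi>\<close>) where
  "Dom\<^sub>\<Psi> p m n = {data_vec p A B C D E F | A B C D E F.
     pgcs_coeffs p m n A B C D E F \<and> invertible_mat (W_mat p m n A B C D)}"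

definition Psi :: "nat \<Rightarrow> nat \<Rightarrow> nat \<Rightarrow> real vec \<Rightarrow> real vec" (\<open>\<Psi>\<close>) where
  "\<Psi> p m n t = (THE z. z \<in> carrier_vec (2 * p * m * n) \<and>
     (\<exists>A B C D E F. pgcs_coeffs p m n A B C D E F \<and> t = data_vec p A B C D E F \<and>
        W_mat p m n A B C D *\<^sub>v z = stack_cols (interleave p m E F)))"

definition H2_block :: "nat \<Rightarrow> nat \<Rightarrow> nat \<Rightarrow>
    (nat \<Rightarrow> real mat) \<Rightarrow> (nat \<Rightarrow> real mat) \<Rightarrow> nat \<Rightarrow> real mat" where
  "H2_block p m n X Y k =
     hcat (m * n)
       [transpose_mat (X k) \<otimes>\<^sub>K 1\<^sub>m m, - (1\<^sub>m n \<otimes>\<^sub>K Y k), - 1\<^sub>m (m * n),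
        0\<^sub>m (m * n) (m * m), 0\<^sub>m (m * n) (n * n), 0\<^sub>m (m * n) (m * n)]
     @\<^sub>r
     hcat (m * n)
       [0\<^sub>m (m * n) (m * m), 0\<^sub>m (m * n) (n * n), 0\<^sub>m (m * n) (m * n),
        transpose_mat (X (k mod p + 1)) \<otimes>\<^sub>K 1\<^sub>m m, - (1\<^sub>m n \<otimes>\<^sub>K Y k), - 1\<^sub>m (m * n)]"

definition H2_mat :: "nat \<Rightarrow> nat \<Rightarrow> nat \<Rightarrow> (nat \<Rightarrow> real mat) \<Rightarrow> (nat \<Rightarrow> real mat) \<Rightarrow> real mat" where
  "H2_mat p m n X Y = diag_block_mat (map (H2_block p m n X Y) [1..<Suc p])"

text \<open>The \<open>j\<close>-th block column (\<open>j\<close> counted from 1, width \<open>mn\<close>) of the identity.\<close>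

definition P_mat :: "nat \<Rightarrow> nat \<Rightarrow> nat \<Rightarrow> nat \<Rightarrow> real mat" where
  "P_mat p m n j = mat (2 * p * m * n) (m * n)
     (\<lambda>(i, l). 1\<^sub>m (2 * p * m * n) $$ (i, (j - 1) * (m * n) + l))"

definition omega :: "nat \<Rightarrow> nat \<Rightarrow> nat \<Rightarrow>
    (nat \<Rightarrow> real mat) \<Rightarrow> (nat \<Rightarrow> real mat) \<Rightarrow> (nat \<Rightarrow> real mat) \<Rightarrow>
    (nat \<Rightarrow> real mat) \<Rightarrow> (nat \<Rightarrow> real mat) \<Rightarrow> (nat \<Rightarrow> real mat) \<Rightarrow>
    (nat \<Rightarrow> real mat) \<Rightarrow> (nat \<Rightarrow> real mat) \<Rightarrow> real vec" where
  "omega p m n A B C D E F X Y =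
    (let Wi = inv_mat (W_mat p m n A B C D); P = P_mat p m n in
     finsum_vec TYPE(real) (2 * p * m * n) (\<lambda>k.
         abs_mat (Wi * P (2 * k - 1) * (transpose_mat (X k) \<otimes>\<^sub>K 1\<^sub>m m)) *\<^sub>v abs_vec (stack_cols (A k))
       + abs_mat (Wi * P (2 * k - 1) * (1\<^sub>m n \<otimes>\<^sub>K Y k)) *\<^sub>v abs_vec (stack_cols (B k))
       + abs_mat (Wi * P (2 * k - 1)) *\<^sub>v abs_vec (stack_cols (E k))
       + abs_mat (Wi * P (2 * k) * (transpose_mat (X (k mod p + 1)) \<otimes>\<^sub>K 1\<^sub>m m)) *\<^sub>v abs_vec (stack_cols (C k))
       + abs_mat (Wi * P (2 * k) * (1\<^sub>m n \<otimes>\<^sub>K Y k)) *\<^sub>v abs_vec (stack_cols (D k))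
       + abs_mat (Wi * P (2 * k)) *\<^sub>v abs_vec (stack_cols (F k)))
     {1..p})"

end

theory Submission
  imports Defs "Jordan_Normal_Form.Determinant"
begin

text \<open>
  For an admissible data vector \<open>x\<close>, write \<open>W x\<close> for its coefficient matrix, and
  let \<open>z = \<Psi> t\<close>. Since \<open>H\<^sub>2 *\<^sub>v x\<close> is the residual of \<open>z\<close>
  in the equation with data \<open>x\<close>, the difference \<open>u = \<Psi> x - z\<close> satisfies the exact
  identity \<open>W x *\<^sub>v u = - (H\<^sub>2 *\<^sub>v (x - t))\<close>. For \<open>x\<close> in \<open>B0 t \<epsilon>\<close> the
  entries of \<open>W x\<close> differ from those of \<open>W\<close> by a relative error of at most \<open>\<epsilon>\<close>,
  hence \<open>u\<close> equals \<open>- W\<^sup>-\<^sup>1 H\<^sub>2 (x - t)\<close> up to \<open>O(\<epsilon>)\<close> times the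
  distance of \<open>x\<close> from \<open>t\<close>. The entries of \<open>|W\<^sup>-\<^sup>1 H\<^sub>2| |t|\<close> bound
  the linear term, and the perturbation of \<open>t\<close> whose signs are those of a row of
  \<open>W\<^sup>-\<^sup>1 H\<^sub>2\<close> attains the bound in that row. Both condition numbers are limits
  of the same weighted quotient: the weights are \<open>1 / norm_inf z\<close> for the mixed one, and
  \<open>1 / z\<^sub>i\<close> (or \<open>1\<close> if \<open>z\<^sub>i = 0\<close>) for the componentwise one.
\<close>

section \<open>Condition numbers of perturbed linear systems\<close>

text \<open>No derivative of \<open>\<Psi>\<close> is taken. Multiplying the exact identity by
  \<open>W\<^sup>-\<^sup>1\<close> leaves an error of at most \<open>\<epsilon> * \<kappa>\<close>
  times the norm of \<open>u\<close> itself, with a constant \<open>\<kappa>\<close> that depends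
  only on \<open>W\<close>. Once this factor is at most 1/2 the error can be absorbed, which bounds
  \<open>u\<close> by a multiple of the distance; put back into the error term, this bound yields
  the second order remainder. Applied to a kernel vector of \<open>W x\<close>, the same estimate
  proves nonsingularity, so small sets \<open>B0 t \<epsilon>\<close> lie in the domain. Relative
  errors of the data pass to \<open>W\<close> unchanged because no entry of \<open>W\<close>
  combines two data: each is zero or, up to sign, a single entry of a coefficient. Two matters of
  encoding shape the rest. The domain and \<open>\<Psi>\<close> are described through families of
  coefficients, so \<open>data_vec\<close> is inverted explicitly. And absolute values of a product
  with the block diagonal \<open>H\<^sub>2\<close> have to be split by blocks, so
  \<open>H\<^sub>2\<close> is rewritten as a row of block columns, through which left multiplication
  and absolute values pass one block at a time.\<close>

lemma norm_inf_ge: "i < dim_vec v \<Longrightarrow> \<bar>v $ i\<bar> \<le> norm_inf v"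
  unfolding norm_inf_def by (rule Max_ge) auto

lemma norm_inf_nonneg: "0 \<le> norm_inf v"
  unfolding norm_inf_def by (rule Max_ge) auto

lemma norm_inf_le:
  assumes "0 \<le> b" and "\<And>i. i < dim_vec v \<Longrightarrow> \<bar>v $ i\<bar> \<le> b"
  shows "norm_inf v \<le> b"
  unfolding norm_inf_def using assms by (subst Max_le_iff) auto

lemma norm_inf_attained:
  assumes "0 < dim_vec v"
  obtains i where "i < dim_vec v" and "norm_inf v = \<bar>v $ i\<bar>"
proof -
  let ?S = "{\<bar>v $ i\<bar> | i. i < dim_vec v}"
  have "norm_inf v \<in> insert 0 ?S"
    unfolding norm_inf_def by (rule Max_in) auto
  then consider "norm_inf v = 0" | "norm_inf v \<in> ?S" by blast
  then show thesis
  proof cases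
    case 1
    \<comment> \<open>The maximum is the inserted \<open>0\<close>, so every entry vanishes and
      index \<open>0\<close> attains it.\<close>
    then have "norm_inf v = \<bar>v $ 0\<bar>" using norm_inf_ge[OF assms] by linarith
    then show thesis using that assms by blast
  next
    case 2
    then show thesis using that by blast
  qed
qed

lemma norm_inf_pos:
  assumes "v \<noteq> 0\<^sub>v (dim_vec v)"
  shows "0 < norm_inf v"
proof (rule ccontr)
  assume "\<not> 0 < norm_inf v"
  then have "\<And>i. i < dim_vec v \<Longrightarrow> v $ i = 0" using norm_inf_ge[of _ v] by fastforce
  then show False using assms by auto
qed

lemma norm_inf_smult: "norm_inf (k \<cdot>\<^sub>v v) = \<bar>k\<bar> * norm_inf v"
proof (cases "dim_vec v = 0")
  case True
  then show ?thesis by (auto simp: norm_inf_def)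
next
  case False
  then obtain i where i: "i < dim_vec v" "norm_inf v = \<bar>v $ i\<bar>"
    using norm_inf_attained by blast
  show ?thesis
  proof (rule antisym)
    show "norm_inf (k \<cdot>\<^sub>v v) \<le> \<bar>k\<bar> * norm_inf v"
      by (rule norm_inf_le) (auto simp: norm_inf_nonneg norm_inf_ge abs_mult mult_left_mono)
    show "\<bar>k\<bar> * norm_inf v \<le> norm_inf (k \<cdot>\<^sub>v v)"
      using norm_inf_ge[of i "k \<cdot>\<^sub>v v"] i by (simp add: abs_mult)
  qed
qed

text \<open>Triangle inequality in one row. The reference \<open>y\<close> is kept apart from
  \<open>x\<close>: later \<open>x\<close> is a perturbation measured against the data, with
  \<open>d\<close> its componentwise distance, or a product \<open>D *\<^sub>v u\<close> measured
  against the row sums of \<open>abs_mat W\<close>.\<close>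

lemma abs_mult_mat_vec_le:
  assumes i: "i < dim_row M" and x: "dim_vec x = dim_col M" and y: "dim_vec y = dim_col M"
    and le: "\<And>j. j < dim_col M \<Longrightarrow> \<bar>x $ j\<bar> \<le> d * \<bar>y $ j\<bar>"
  shows "\<bar>(M *\<^sub>v x) $ i\<bar> \<le> d * (abs_mat M *\<^sub>v abs_vec y) $ i"
proof -
  have "\<bar>(M *\<^sub>v x) $ i\<bar> = \<bar>\<Sum>j<dim_col M. M $$ (i, j) * x $ j\<bar>"
    using i x by (simp add: scalar_prod_def lessThan_atLeast0)
  also have "\<dots> \<le> (\<Sum>j<dim_col M. \<bar>M $$ (i, j)\<bar> * \<bar>x $ j\<bar>)"
    by (rule order_trans[OF sum_abs]) (simp add: abs_mult)
  also have "\<dots> \<le> (\<Sum>j<dim_col M. \<bar>M $$ (i, j)\<bar> * (d * \<bar>y $ j\<bar>))"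
    by (intro sum_mono mult_left_mono) (auto simp: le)
  also have "\<dots> = d * (abs_mat M *\<^sub>v abs_vec y) $ i"
    using i y by (simp add: scalar_prod_def lessThan_atLeast0 abs_mat_def abs_vec_def
        sum_distrib_left mult_ac)
  finally show ?thesis .
qed

text \<open>At a zero entry of \<open>a\<close> the division convention lets \<open>cdist\<close>
  bound only the entry of \<open>x\<close>, whereas the claim needs that entry to vanish; membership
  in \<open>B0\<close> supplies this.\<close>

lemma B0_cdist:
  assumes x: "x \<in> B0 a \<epsilon>" and i: "i < dim_vec a"
  shows "\<bar>x $ i - a $ i\<bar> \<le> cdist x a * \<bar>a $ i\<bar>"
proof (cases "a $ i = 0")
  case True
  then show ?thesis using x i by (auto simp: B0_def)
next
  case False
  have "\<bar>entry_div (x - a) a $ i\<bar> \<le> cdist x a"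
    unfolding cdist_def by (rule norm_inf_ge) (simp add: entry_div_def i)
  then have "\<bar>(x $ i - a $ i) / a $ i\<bar> \<le> cdist x a"
    using i False x by (simp add: entry_div_def)
  then show ?thesis using False by (simp add: abs_divide field_simps)
qed

lemma cdist_pos:
  assumes x: "x \<in> B0 a \<epsilon>" and "x \<noteq> a"
  shows "0 < cdist x a"
proof -
  have "cdist x a \<noteq> 0"
  proof
    assume "cdist x a = 0"
    then have "\<And>i. i < dim_vec a \<Longrightarrow> x $ i = a $ i" using B0_cdist[OF x] by auto
    then show False using \<open>x \<noteq> a\<close> x by (auto simp: B0_def)
  qed
  then show ?thesis using norm_inf_nonneg unfolding cdist_def by (simp add: order_less_le)
qed

text \<open>Extremal points of \<open>B0\<close>: every entry moves by the full relative amount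
  \<open>\<epsilon>\<close>, with free signs. A nonzero entry of \<open>a\<close> makes the distance
  exactly \<open>\<epsilon>\<close>; for \<open>a = 0\<close> the set \<open>B0\<close> would
  consist of \<open>a\<close> alone.\<close>

lemma sign_perturbation:
  assumes a: "a \<noteq> 0\<^sub>v (dim_vec a)" and "0 < \<epsilon>"
    and s: "\<And>j. s j = 1 \<or> s j = (- 1 :: real)"
  defines "x \<equiv> vec (dim_vec a) (\<lambda>j. a $ j + \<epsilon> * s j * \<bar>a $ j\<bar>)"
  shows "x \<in> B0 a \<epsilon>" and "x \<noteq> a" and "cdist x a = \<epsilon>"
proof -
  have s1: "\<bar>s j\<bar> = 1" for j using s[of j] by auto
  show xB: "x \<in> B0 a \<epsilon>"
    using \<open>0 < \<epsilon>\<close> by (simp add: B0_def x_def abs_mult s1)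
  obtain j where j: "j < dim_vec a" "a $ j \<noteq> 0"
    using a eq_vecI[of a "0\<^sub>v (dim_vec a)"] by auto
  have "x $ j \<noteq> a $ j" using j \<open>0 < \<epsilon>\<close> s1[of j] by (auto simp: x_def)
  then show "x \<noteq> a" by auto
  show "cdist x a = \<epsilon>"
  proof (rule antisym)
    show "cdist x a \<le> \<epsilon>"
      unfolding cdist_def
      by (rule norm_inf_le) (use \<open>0 < \<epsilon>\<close> in \<open>auto simp: entry_div_def x_def abs_mult s1\<close>)
    have "\<epsilon> * \<bar>a $ j\<bar> = \<bar>x $ j - a $ j\<bar>"
      using j \<open>0 < \<epsilon>\<close> by (simp add: x_def abs_mult s1)
    also have "\<dots> \<le> cdist x a * \<bar>a $ j\<bar>" by (rule B0_cdist[OF xB j(1)])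
    finally show "\<epsilon> \<le> cdist x a" using j by simp
  qed
qed

section \<open>Inverses, nonsingularity and small perturbations of a matrix\<close>

lemma inv_mat_inverts:
  assumes W: "W \<in> carrier_mat N N" and "invertible_mat W"
  shows "inv_mat W \<in> carrier_mat N N" "inv_mat W * W = 1\<^sub>m N" "W * inv_mat W = 1\<^sub>m N"
proof -
  obtain B where B: "inverts_mat W B" "inverts_mat B W"
    using assms(2) by (auto simp: invertible_mat_def)
  \<comment> \<open>Each half of \<open>inverts_mat\<close> mentions only the row dimension of its
    left factor. Comparing the dimensions of both products makes \<open>B\<close> square of order
    \<open>N\<close>, as membership in \<open>Units\<close> requires.\<close>
  have d: "dim_row B = N" "dim_col B = N"
    using B W unfolding inverts_mat_def
    by (metis carrier_matD index_mult_mat(2,3) index_one_mat(2,3))+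
  then have "W \<in> Units (ring_mat TYPE(real) N undefined)"
    using B W by (auto simp: Units_def ring_mat_def inverts_mat_def intro!: bexI[of _ B])
  then obtain V where "mat_inverse W = Some V"
    using mat_inverse(1)[OF W] by fastforce
  with mat_inverse(2)[OF W this]
  show "inv_mat W \<in> carrier_mat N N" "inv_mat W * W = 1\<^sub>m N" "W * inv_mat W = 1\<^sub>m N"
    by (auto simp: inv_mat_def)
qed

text \<open>A kernel vector can be excluded by a norm estimate, which is how perturbed coefficient
  matrices are shown to be nonsingular.\<close>

lemma invertible_mat_if_trivial_kernel:
  fixes W :: "real mat"
  assumes W: "W \<in> carrier_mat N N"
    and ker: "\<And>v. v \<in> carrier_vec N \<Longrightarrow> W *\<^sub>v v = 0\<^sub>v N \<Longrightarrow> v = 0\<^sub>v N"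
  shows "invertible_mat W"
proof -
  have "det W \<noteq> 0" using det_0_iff_vec_prod_zero_field[OF W] ker by blast
  from det_non_zero_imp_unit[OF W this, of undefined] obtain B where
    "B \<in> carrier_mat N N" "B * W = 1\<^sub>m N" "W * B = 1\<^sub>m N"
    by (auto simp: Units_def ring_mat_def)
  then show ?thesis using W by (auto simp: invertible_mat_def inverts_mat_def)
qed

text \<open>The constant is the largest row sum of \<open>abs_mat V * abs_mat W\<close>; for
  \<open>V\<close> the inverse of \<open>W\<close> it is the Skeel condition number of
  \<open>W\<close>. It is independent of \<open>D\<close> and \<open>u\<close> because the entries
  of \<open>D\<close> are measured relative to those of \<open>W\<close>.\<close>

lemma abs_mult_perturbation_le:
  assumes V: "V \<in> carrier_mat N N" and W: "W \<in> carrier_mat N N" and D: "D \<in> carrier_mat N N"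
    and u: "u \<in> carrier_vec N" and "0 \<le> \<epsilon>"
    and le: "\<And>i j. i < N \<Longrightarrow> j < N \<Longrightarrow> \<bar>D $$ (i, j)\<bar> \<le> \<epsilon> * \<bar>W $$ (i, j)\<bar>"
    and i: "i < N"
  shows "\<bar>(V *\<^sub>v (D *\<^sub>v u)) $ i\<bar>
    \<le> \<epsilon> * norm_inf (abs_mat V *\<^sub>v (abs_mat W *\<^sub>v vec N (\<lambda>_. 1))) * norm_inf u"
proof -
  let ?y = "abs_mat W *\<^sub>v vec N (\<lambda>_. 1)"
  have y: "?y $ j = (\<Sum>l<N. \<bar>W $$ (j, l)\<bar>)" if "j < N" for j
    using that W by (simp add: scalar_prod_def lessThan_atLeast0 abs_mat_def)
  have y0: "0 \<le> ?y $ j" if "j < N" for j by (simp add: y that sum_nonneg)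
  have Du: "\<bar>(D *\<^sub>v u) $ j\<bar> \<le> (\<epsilon> * norm_inf u) * \<bar>?y $ j\<bar>" if j: "j < N" for j
  proof -
    have "\<bar>(D *\<^sub>v u) $ j\<bar> = \<bar>\<Sum>l<N. D $$ (j, l) * u $ l\<bar>"
      using j D u by (simp add: scalar_prod_def lessThan_atLeast0)
    also have "\<dots> \<le> (\<Sum>l<N. \<bar>D $$ (j, l)\<bar> * \<bar>u $ l\<bar>)"
      by (rule order_trans[OF sum_abs]) (simp add: abs_mult)
    also have "\<dots> \<le> (\<Sum>l<N. (\<epsilon> * \<bar>W $$ (j, l)\<bar>) * norm_inf u)"
      using u by (intro sum_mono mult_mono) (auto simp: le j norm_inf_ge \<open>0 \<le> \<epsilon>\<close>)
    also have "\<dots> = (\<epsilon> * norm_inf u) * ?y $ j"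
      by (simp add: y j sum_distrib_left mult_ac)
    finally show ?thesis using y0[OF j] by simp
  qed
  have "\<bar>(V *\<^sub>v (D *\<^sub>v u)) $ i\<bar> \<le> (\<epsilon> * norm_inf u) * (abs_mat V *\<^sub>v abs_vec ?y) $ i"
    by (rule abs_mult_mat_vec_le) (use V D W i Du in \<open>auto simp: abs_mat_def\<close>)
  also have "abs_vec ?y = ?y"
    using y0 W by (intro eq_vecI) (auto simp: abs_vec_def abs_mat_def)
  also have "(\<epsilon> * norm_inf u) * (abs_mat V *\<^sub>v ?y) $ i
      \<le> (\<epsilon> * norm_inf u) * norm_inf (abs_mat V *\<^sub>v ?y)"
  proof (rule mult_left_mono)
    have "\<bar>(abs_mat V *\<^sub>v ?y) $ i\<bar> \<le> norm_inf (abs_mat V *\<^sub>v ?y)"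
      by (rule norm_inf_ge) (use V i in \<open>auto simp: abs_mat_def\<close>)
    then show "(abs_mat V *\<^sub>v ?y) $ i \<le> norm_inf (abs_mat V *\<^sub>v ?y)" by linarith
  qed (auto simp: \<open>0 \<le> \<epsilon>\<close> norm_inf_nonneg)
  finally show ?thesis by (simp add: mult_ac)
qed

text \<open>The analysis, separated from the structure of the equation: \<open>F\<close> enters only
  through the identity for its increment, and \<open>Wf\<close> through its entrywise relative
  closeness to \<open>W\<close>. Arbitrary weights \<open>c\<close> let one limit serve both
  condition numbers; \<open>dom\<close> turns nonsingularity into membership in the domain.\<close>

lemma weighted_condition_limit:
  fixes F :: "real vec \<Rightarrow> real vec" and Wf :: "real vec \<Rightarrow> real mat" and c :: "nat \<Rightarrow> real"
  assumes N: "0 < N" and a: "a \<noteq> 0\<^sub>v (dim_vec a)"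
    and V: "V \<in> carrier_mat N N" and H: "H \<in> carrier_mat N (dim_vec a)"
    and W: "W \<in> carrier_mat N N" and VW: "V * W = 1\<^sub>m N"
    and carr: "\<And>x. x \<in> carrier_vec (dim_vec a) \<Longrightarrow> Wf x \<in> carrier_mat N N"
    and near: "\<And>x \<epsilon> i j. 0 < \<epsilon> \<Longrightarrow> x \<in> B0 a \<epsilon> \<Longrightarrow> i < N \<Longrightarrow> j < N \<Longrightarrow>
        \<bar>(Wf x - W) $$ (i, j)\<bar> \<le> \<epsilon> * \<bar>W $$ (i, j)\<bar>"
    and dom: "\<And>x. x \<in> carrier_vec (dim_vec a) \<Longrightarrow> invertible_mat (Wf x) \<Longrightarrow> x \<in> D"
    and F: "\<And>x. x \<in> D \<Longrightarrow> x \<in> carrier_vec (dim_vec a) \<Longrightarrow> F x - F a \<in> carrier_vec N \<and>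
        Wf x *\<^sub>v (F x - F a) = - (H *\<^sub>v (x - a))"
  defines "\<theta> \<equiv> abs_mat (V * H) *\<^sub>v abs_vec a"
  shows "Lim (at_right 0) (\<lambda>\<epsilon>. SUP x \<in> {x \<in> B0 a \<epsilon> \<inter> D. x \<noteq> a}.
       ereal (norm_inf (vec N (\<lambda>i. c i * (F x - F a) $ i)) / cdist x a))
     = ereal (norm_inf (vec N (\<lambda>i. c i * \<theta> $ i)))"
proof -
  \<comment> \<open>\<open>\<kappa>\<close> measures the effect of perturbing \<open>W\<close>,
    \<open>\<Theta>\<close> the size of the linear term. \<open>L\<close> is the limit of the
    suprema, and \<open>K\<close> is the coefficient of \<open>\<epsilon>\<close> in the bound for
    their deviation from \<open>L\<close>.\<close>
  define \<kappa> where "\<kappa> = norm_inf (abs_mat V *\<^sub>v (abs_mat W *\<^sub>v vec N (\<lambda>_. 1)))"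
  define \<Theta> where "\<Theta> = norm_inf \<theta>"
  define G where "G x = norm_inf (vec N (\<lambda>i. c i * (F x - F a) $ i)) / cdist x a" for x
  define L where "L = norm_inf (vec N (\<lambda>i. c i * \<theta> $ i))"
  define cm where "cm = norm_inf (vec N c)"
  define K where "K = cm * (2 * \<kappa> * \<Theta>)"
  have nn: "0 \<le> \<kappa>" "0 \<le> \<Theta>" "0 \<le> cm" "0 \<le> L"
    by (simp_all add: \<kappa>_def \<Theta>_def cm_def L_def norm_inf_nonneg)
  have cm: "\<bar>c i\<bar> \<le> cm" if "i < N" for i
    using norm_inf_ge[of i "vec N c"] that by (simp add: cm_def)
  have VH: "V * H \<in> carrier_mat N (dim_vec a)" using V H by simp
  have dim\<theta>: "dim_vec \<theta> = N" using V by (simp add: \<theta>_def abs_mat_def)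
  have \<theta>0: "0 \<le> \<theta> $ i" if "i < N" for i
    using that V H by (auto simp: \<theta>_def abs_mat_def abs_vec_def scalar_prod_def intro!: sum_nonneg)
  have \<theta>\<Theta>: "\<theta> $ i \<le> \<Theta>" if "i < N" for i
    using norm_inf_ge[of i \<theta>] that dim\<theta> unfolding \<Theta>_def by simp

  \<comment> \<open>Insert \<open>V * W = 1\<^sub>m N\<close> and write \<open>W\<close> as
    \<open>Wf x - (Wf x - W)\<close>: the first part is known from the identity for the increment,
    the second is small.\<close>
  have split: "u $ i = (V *\<^sub>v (Wf x *\<^sub>v u)) $ i - (V *\<^sub>v ((Wf x - W) *\<^sub>v u)) $ i"
    if u: "u \<in> carrier_vec N" and x: "x \<in> carrier_vec (dim_vec a)" and i: "i < N" for u x i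
  proof -
    have "u = (V * W) *\<^sub>v u" using u VW by simp
    also have "\<dots> = V *\<^sub>v (W *\<^sub>v u)" using V W u by simp
    also have "W *\<^sub>v u = Wf x *\<^sub>v u - (Wf x - W) *\<^sub>v u"
      using carr[OF x] W u by (intro eq_vecI) (auto simp: minus_mult_distrib_mat_vec)
    also have "V *\<^sub>v \<dots> = V *\<^sub>v (Wf x *\<^sub>v u) - V *\<^sub>v ((Wf x - W) *\<^sub>v u)"
      by (rule mult_minus_distrib_mat_vec[OF V]) (use W u carr[OF x] in \<open>auto intro!: carrier_vecI\<close>)
    finally show ?thesis using V W carr[OF x] i
      by (metis carrier_matD(1) dim_mult_mat_vec index_minus_vec(1))
  qed
  have rem: "\<bar>(V *\<^sub>v ((Wf x - W) *\<^sub>v u)) $ i\<bar> \<le> \<epsilon> * \<kappa> * norm_inf u"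
    if u: "u \<in> carrier_vec N" and x: "x \<in> B0 a \<epsilon>" and i: "i < N" and "0 < \<epsilon>" for u x i \<epsilon>
    unfolding \<kappa>_def
    by (rule abs_mult_perturbation_le)
      (use V W u i near[OF \<open>0 < \<epsilon>\<close> x] carr[of x] \<open>0 < \<epsilon>\<close> x in \<open>auto simp: B0_def\<close>)

  \<comment> \<open>For a kernel vector \<open>v\<close> of \<open>Wf x\<close> only the small part
    of \<open>split\<close> remains, so the norm of \<open>v\<close> is at most half of
    itself.\<close>
  have inD: "x \<in> D" if x: "x \<in> B0 a \<epsilon>" and \<epsilon>: "0 < \<epsilon>" "\<epsilon> * \<kappa> \<le> 1/2" for x \<epsilon>
  proof -
    have xc: "x \<in> carrier_vec (dim_vec a)" using x by (simp add: B0_def)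
    have "invertible_mat (Wf x)"
    proof (rule invertible_mat_if_trivial_kernel[OF carr[OF xc]])
      fix v assume v: "v \<in> carrier_vec N" and "Wf x *\<^sub>v v = 0\<^sub>v N"
      then have *: "\<bar>v $ i\<bar> \<le> \<epsilon> * \<kappa> * norm_inf v" if "i < N" for i
        using split[OF v xc that] rem[OF v x that \<epsilon>(1)] that V by simp
      have "norm_inf v \<le> \<epsilon> * \<kappa> * norm_inf v"
        by (rule norm_inf_le) (use * \<epsilon> nn v in \<open>auto simp: norm_inf_nonneg\<close>)
      also have "\<dots> \<le> 1/2 * norm_inf v"
        by (rule mult_right_mono) (use \<epsilon> in \<open>auto simp: norm_inf_nonneg\<close>)
      finally have "norm_inf v \<le> 0" by simp
      then show "v = 0\<^sub>v N" using norm_inf_pos[of v] v by fastforce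
    qed
    then show ?thesis by (rule dom[OF xc])
  qed

  have est: "\<bar>(F x - F a) $ i + ((V * H) *\<^sub>v (x - a)) $ i\<bar> \<le> \<epsilon> * (2 * \<kappa> * \<Theta>) * cdist x a"
      "\<bar>((V * H) *\<^sub>v (x - a)) $ i\<bar> \<le> cdist x a * \<theta> $ i"
    if x: "x \<in> B0 a \<epsilon>" and xD: "x \<in> D" and \<epsilon>: "0 < \<epsilon>" "\<epsilon> * \<kappa> \<le> 1/2" and i: "i < N" for x \<epsilon> i
  proof -
    have xc: "x \<in> carrier_vec (dim_vec a)" using x by (simp add: B0_def)
    define u where "u = F x - F a"
    define h where "h = (V * H) *\<^sub>v (x - a)"
    have u: "u \<in> carrier_vec N" and Wu: "Wf x *\<^sub>v u = - (H *\<^sub>v (x - a))"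
      using F[OF xD xc] by (auto simp: u_def)
    have "V *\<^sub>v (- (H *\<^sub>v (x - a))) = - h"
    proof -
      have "V *\<^sub>v (- (H *\<^sub>v (x - a))) = - (V *\<^sub>v (H *\<^sub>v (x - a)))"
        using V H by (intro eq_vecI) auto
      also have "V *\<^sub>v (H *\<^sub>v (x - a)) = h"
        unfolding h_def by (rule assoc_mult_mat_vec[symmetric, OF V H]) (auto intro!: carrier_vecI)
      finally show ?thesis .
    qed
    then have uh: "\<bar>u $ i + h $ i\<bar> \<le> \<epsilon> * \<kappa> * norm_inf u" if "i < N" for i
      using split[OF u xc that] rem[OF u x that \<epsilon>(1)] that V by (simp add: Wu h_def)
    have h: "\<bar>h $ i\<bar> \<le> cdist x a * \<theta> $ i" if "i < N" for i
      unfolding h_def \<theta>_def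
      by (rule abs_mult_mat_vec_le) (use that VH xc B0_cdist[OF x] H V in auto)
    have d0: "0 \<le> cdist x a" by (simp add: cdist_def norm_inf_nonneg)
    \<comment> \<open>The norm of \<open>u\<close> occurs on both sides, on the right with a factor
      of at most 1/2. Absorbing it produces the 2 in \<open>2 * \<kappa> * \<Theta>\<close>;
      substituting the result into \<open>uh\<close> makes the remainder of order
      \<open>\<epsilon>\<close> times the distance.\<close>
    have "norm_inf u \<le> \<epsilon> * \<kappa> * norm_inf u + cdist x a * \<Theta>"
    proof (rule norm_inf_le)
      show "0 \<le> \<epsilon> * \<kappa> * norm_inf u + cdist x a * \<Theta>"
        using nn \<epsilon> d0 norm_inf_nonneg[of u] by simp
      fix i assume "i < dim_vec u"
      then have i: "i < N" using u by simp
      have "cdist x a * \<theta> $ i \<le> cdist x a * \<Theta>" using \<theta>\<Theta>[OF i] d0 by (rule mult_left_mono)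
      then show "\<bar>u $ i\<bar> \<le> \<epsilon> * \<kappa> * norm_inf u + cdist x a * \<Theta>"
        using uh[OF i] h[OF i] by linarith
    qed
    also have "\<epsilon> * \<kappa> * norm_inf u \<le> 1/2 * norm_inf u"
      by (rule mult_right_mono) (use \<epsilon> in \<open>auto simp: norm_inf_nonneg\<close>)
    finally have "norm_inf u \<le> 2 * cdist x a * \<Theta>" by simp
    then have "\<epsilon> * \<kappa> * norm_inf u \<le> \<epsilon> * \<kappa> * (2 * cdist x a * \<Theta>)"
      by (rule mult_left_mono) (use \<epsilon> nn in auto)
    then show "\<bar>(F x - F a) $ i + ((V * H) *\<^sub>v (x - a)) $ i\<bar> \<le> \<epsilon> * (2 * \<kappa> * \<Theta>) * cdist x a"
      using uh[OF i] unfolding u_def h_def by (simp add: mult_ac)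
    show "\<bar>((V * H) *\<^sub>v (x - a)) $ i\<bar> \<le> cdist x a * \<theta> $ i"
      using h[OF i] unfolding h_def .
  qed

  have upper: "G x \<le> L + \<epsilon> * K"
    if x: "x \<in> B0 a \<epsilon>" and xD: "x \<in> D" and xa: "x \<noteq> a" and \<epsilon>: "0 < \<epsilon>" "\<epsilon> * \<kappa> \<le> 1/2" for x \<epsilon>
  proof -
    have d: "0 < cdist x a" by (rule cdist_pos[OF x xa])
    have "norm_inf (vec N (\<lambda>i. c i * (F x - F a) $ i)) \<le> (L + \<epsilon> * K) * cdist x a"
    proof (rule norm_inf_le)
      show "0 \<le> (L + \<epsilon> * K) * cdist x a" using d nn \<epsilon> by (simp add: K_def)
      fix i assume "i < dim_vec (vec N (\<lambda>i. c i * (F x - F a) $ i))"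
      then have i: "i < N" by simp
      have "\<bar>(F x - F a) $ i\<bar> \<le> cdist x a * \<theta> $ i + \<epsilon> * (2 * \<kappa> * \<Theta>) * cdist x a"
        using est[OF x xD \<epsilon> i] by linarith
      then have "\<bar>c i\<bar> * \<bar>(F x - F a) $ i\<bar>
          \<le> \<bar>c i\<bar> * (cdist x a * \<theta> $ i + \<epsilon> * (2 * \<kappa> * \<Theta>) * cdist x a)"
        by (rule mult_left_mono) simp
      also have "\<dots> = (\<bar>c i\<bar> * \<theta> $ i) * cdist x a + \<bar>c i\<bar> * (\<epsilon> * (2 * \<kappa> * \<Theta>) * cdist x a)"
        by (simp add: algebra_simps)
      \<comment> \<open>Each row keeps its own weight in the leading term, which gives exactly
        \<open>L\<close>; only the remainder is bounded with the largest weight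
        \<open>cm\<close>.\<close>
      also have "\<dots> \<le> L * cdist x a + cm * (\<epsilon> * (2 * \<kappa> * \<Theta>) * cdist x a)"
      proof (intro add_mono mult_right_mono)
        show "\<bar>c i\<bar> * \<theta> $ i \<le> L"
          using norm_inf_ge[of i "vec N (\<lambda>i. c i * \<theta> $ i)"] i \<theta>0[OF i]
          by (simp add: L_def abs_mult)
      qed (use d nn \<epsilon> cm[OF i] in auto)
      also have "\<dots> = (L + \<epsilon> * K) * cdist x a" by (simp add: K_def algebra_simps)
      finally show "\<bar>vec N (\<lambda>i. c i * (F x - F a) $ i) $ i\<bar> \<le> (L + \<epsilon> * K) * cdist x a"
        using i by (simp add: abs_mult)
    qed
    then show ?thesis using d by (simp add: G_def field_simps)
  qed

  have lower: "\<exists>x \<in> B0 a \<epsilon> \<inter> D. x \<noteq> a \<and> L - \<epsilon> * K \<le> G x"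
    if \<epsilon>: "0 < \<epsilon>" "\<epsilon> * \<kappa> \<le> 1/2" for \<epsilon>
  proof -
    \<comment> \<open>The witness is tailored to a row \<open>i\<close> in which \<open>L\<close> is
      attained: with the signs of row \<open>i\<close> of \<open>V * H\<close> the terms of that row
      add up without cancellation to \<open>\<epsilon> * \<theta> $ i\<close>.\<close>
    obtain i where i: "i < N" and Li: "L = \<bar>c i\<bar> * \<theta> $ i"
      using norm_inf_attained[of "vec N (\<lambda>i. c i * \<theta> $ i)"] N \<theta>0
      by (auto simp: L_def abs_mult)
    \<comment> \<open>Unlike the usual sign function this is never zero, as
      \<open>sign_perturbation\<close> demands.\<close>
    define s :: "nat \<Rightarrow> real" where "s j = (if 0 \<le> (V * H) $$ (i, j) then 1 else - 1)" for j
    define x where "x = vec (dim_vec a) (\<lambda>j. a $ j + \<epsilon> * s j * \<bar>a $ j\<bar>)"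
    have s: "s j = 1 \<or> s j = - 1" for j by (simp add: s_def)
    note x = sign_perturbation[of a \<epsilon> s, OF a \<epsilon>(1) s, folded x_def]
    have xD: "x \<in> D" by (rule inD[OF x(1) \<epsilon>])
    have "((V * H) *\<^sub>v (x - a)) $ i = (\<Sum>j<dim_vec a. (V * H) $$ (i, j) * (\<epsilon> * s j * \<bar>a $ j\<bar>))"
      using i V H by (simp add: scalar_prod_def lessThan_atLeast0 x_def del: assoc_mult_mat_vec)
    also have "\<dots> = (\<Sum>j<dim_vec a. \<epsilon> * (\<bar>(V * H) $$ (i, j)\<bar> * \<bar>a $ j\<bar>))"
      by (intro sum.cong refl) (simp add: s_def)
    also have "\<dots> = \<epsilon> * \<theta> $ i"
      using i V H by (simp add: \<theta>_def abs_mat_def abs_vec_def scalar_prod_def lessThan_atLeast0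
          sum_distrib_left)
    finally have "\<bar>(F x - F a) $ i + \<epsilon> * \<theta> $ i\<bar> \<le> \<epsilon> * (2 * \<kappa> * \<Theta>) * \<epsilon>"
      using est(1)[OF x(1) xD \<epsilon> i] x(3) by simp
    then have "\<epsilon> * \<theta> $ i - \<epsilon> * (2 * \<kappa> * \<Theta>) * \<epsilon> \<le> \<bar>(F x - F a) $ i\<bar>"
      by linarith
    then have "\<bar>c i\<bar> * (\<epsilon> * \<theta> $ i - \<epsilon> * (2 * \<kappa> * \<Theta>) * \<epsilon>) \<le> \<bar>c i\<bar> * \<bar>(F x - F a) $ i\<bar>"
      by (rule mult_left_mono) simp
    also have "\<dots> \<le> norm_inf (vec N (\<lambda>i. c i * (F x - F a) $ i))"
      using norm_inf_ge[of i "vec N (\<lambda>i. c i * (F x - F a) $ i)"] i by (simp add: abs_mult)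
    finally have "L * \<epsilon> - \<bar>c i\<bar> * (\<epsilon> * (2 * \<kappa> * \<Theta>) * \<epsilon>)
        \<le> norm_inf (vec N (\<lambda>i. c i * (F x - F a) $ i))"
      by (simp add: Li algebra_simps)
    moreover have "\<bar>c i\<bar> * (\<epsilon> * (2 * \<kappa> * \<Theta>) * \<epsilon>) \<le> cm * (\<epsilon> * (2 * \<kappa> * \<Theta>) * \<epsilon>)"
      by (rule mult_right_mono) (use nn \<epsilon> cm[OF i] in auto)
    ultimately have "(L - \<epsilon> * K) * \<epsilon> \<le> norm_inf (vec N (\<lambda>i. c i * (F x - F a) $ i))"
      by (simp add: K_def algebra_simps)
    then have "L - \<epsilon> * K \<le> G x" using \<epsilon> x(3) by (simp add: G_def field_simps)
    then show ?thesis using x xD by blast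
  qed

  let ?S = "\<lambda>\<epsilon>. SUP x \<in> {x \<in> B0 a \<epsilon> \<inter> D. x \<noteq> a}. ereal (G x)"
  \<comment> \<open>The threshold \<open>1 / (2 * \<kappa> + 2)\<close> forces
    \<open>\<epsilon> * \<kappa> \<le> 1/2\<close>; the summand 2 keeps it well defined for
    \<open>\<kappa> = 0\<close>.\<close>
  have small: "eventually (\<lambda>\<epsilon>. 0 < \<epsilon> \<and> \<epsilon> * \<kappa> \<le> 1/2) (at_right (0::real))"
    unfolding eventually_at_right_field
  proof (intro exI[of _ "1 / (2 * \<kappa> + 2)"] conjI allI impI)
    show "0 < 1 / (2 * \<kappa> + 2)" using nn by simp
    fix \<epsilon> :: real assume e: "0 < \<epsilon>" "\<epsilon> < 1 / (2 * \<kappa> + 2)"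
    then have "\<epsilon> * (2 * \<kappa> + 2) < 1" using nn by (simp add: field_simps)
    then show "\<epsilon> * \<kappa> \<le> 1/2" using e by (simp add: algebra_simps)
  qed auto
  have "(?S \<longlongrightarrow> ereal L) (at_right 0)"
  proof (rule tendsto_sandwich)
    show "eventually (\<lambda>\<epsilon>. ereal (L - \<epsilon> * K) \<le> ?S \<epsilon>) (at_right 0)"
      using small
    proof eventually_elim
      case (elim \<epsilon>)
      then obtain x where "x \<in> {x \<in> B0 a \<epsilon> \<inter> D. x \<noteq> a}" "L - \<epsilon> * K \<le> G x"
        using lower by blast
      then show ?case by (intro SUP_upper2[of x]) auto
    qed
    show "eventually (\<lambda>\<epsilon>. ?S \<epsilon> \<le> ereal (L + \<epsilon> * K)) (at_right 0)"
      using small by eventually_elim (rule SUP_least, use upper in auto)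
    have "((\<lambda>\<epsilon>. L - \<epsilon> * K) \<longlongrightarrow> L - 0 * K) (at_right 0)" by (intro tendsto_intros)
    then show "((\<lambda>\<epsilon>. ereal (L - \<epsilon> * K)) \<longlongrightarrow> ereal L) (at_right 0)" by simp
    have "((\<lambda>\<epsilon>. L + \<epsilon> * K) \<longlongrightarrow> L + 0 * K) (at_right 0)" by (intro tendsto_intros)
    then show "((\<lambda>\<epsilon>. ereal (L + \<epsilon> * K)) \<longlongrightarrow> ereal L) (at_right 0)" by simp
  qed
  then show ?thesis
    unfolding G_def L_def by (intro tendsto_Lim) auto
qed

section \<open>Vectorization and Kronecker products\<close>

text \<open>A flat index is a block number together with a position inside the block. This
  regrouping underlies the products with Kronecker products and with \<open>W\<close>.\<close>

lemma sum_div_mod: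
  fixes f :: "nat \<Rightarrow> nat \<Rightarrow> 'a::comm_monoid_add"
  shows "(\<Sum>j<u * v. f (j div v) (j mod v)) = (\<Sum>x<u. \<Sum>y<v. f x y)"
proof -
  have "(\<Sum>j<u * v. f (j div v) (j mod v))
      = (\<Sum>x<u. sum (\<lambda>j. f (j div v) (j mod v)) {x * v..<x * v + v})"
    by (rule sum.nat_group[symmetric])
  also have "\<dots> = (\<Sum>x<u. \<Sum>y<v. f x y)"
  proof (rule sum.cong[OF refl])
    fix x
    have "sum (\<lambda>j. f (j div v) (j mod v)) {x * v..<x * v + v}
        = (\<Sum>y<v. f ((x * v + y) div v) ((x * v + y) mod v))"
      by (subst sum.atLeastLessThan_shift_0) (simp add: lessThan_atLeast0)
    also have "\<dots> = (\<Sum>y<v. f x y)" by (intro sum.cong refl) auto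
    finally show "sum (\<lambda>j. f (j div v) (j mod v)) {x * v..<x * v + v} = (\<Sum>y<v. f x y)" .
  qed
  finally show ?thesis .
qed

lemma length_concat_uniform:
  "(\<And>xs. xs \<in> set xss \<Longrightarrow> length xs = L) \<Longrightarrow> length (concat xss) = length xss * L"
  by (induction xss) auto

lemma nth_concat_uniform:
  assumes "\<And>xs. xs \<in> set xss \<Longrightarrow> length xs = L" and "i < length xss * L"
  shows "concat xss ! i = xss ! (i div L) ! (i mod L)"
  using assms
proof (induction xss arbitrary: i)
  case (Cons xs xss)
  have L: "length xs = L" "0 < L" using Cons.prems by (auto intro: Nat.gr0I)
  show ?case
  proof (cases "i < L")
    case True
    then show ?thesis using L by (simp add: nth_append)
  next
    case False
    then have "concat xss ! (i - L) = xss ! ((i - L) div L) ! ((i - L) mod L)"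
      using Cons by auto
    moreover have "i div L = Suc ((i - L) div L)" "i mod L = (i - L) mod L"
      using False L by (auto simp: le_div_geq le_mod_geq)
    ultimately show ?thesis using False L by (simp add: nth_append)
  qed
qed simp

lemma stack_cols_eq:
  "stack_cols M = vec (dim_row M * dim_col M) (\<lambda>i. M $$ (i mod dim_row M, i div dim_row M))"
proof -
  let ?xss = "map list_of_vec (cols M)"
  have u: "length xs = dim_row M" if "xs \<in> set ?xss" for xs
    using that by (auto simp: cols_def)
  have l: "length (concat ?xss) = dim_row M * dim_col M"
    using length_concat_uniform[of ?xss, OF u] by simp
  show ?thesis
  proof (intro eq_vecI)
    fix i assume "i < dim_vec (vec (dim_row M * dim_col M)
      (\<lambda>i. M $$ (i mod dim_row M, i div dim_row M)))"
    then have i: "i < dim_col M * dim_row M" by (simp add: mult.commute)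
    then have "0 < dim_row M" by (auto intro: Nat.gr0I)
    then have "i div dim_row M < dim_col M" "i mod dim_row M < dim_row M"
      using i by (auto simp: less_mult_imp_div_less)
    moreover have "concat ?xss ! i = ?xss ! (i div dim_row M) ! (i mod dim_row M)"
      by (rule nth_concat_uniform[OF u]) (use i in simp_all)
    ultimately show "stack_cols M $ i = vec (dim_row M * dim_col M)
      (\<lambda>i. M $$ (i mod dim_row M, i div dim_row M)) $ i"
      using i l by (simp add: stack_cols_def vec_of_list_index mult.commute)
  qed (use l in \<open>simp add: stack_cols_def\<close>)
qed

lemma dim_stack_cols [simp]: "dim_vec (stack_cols M) = dim_row M * dim_col M"
  by (simp add: stack_cols_eq)

lemma stack_cols_carrier: "M \<in> carrier_mat r c \<Longrightarrow> stack_cols M \<in> carrier_vec (r * c)"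
  by (intro carrier_vecI) auto

lemma stack_cols_index:
  "i < dim_row M * dim_col M \<Longrightarrow> stack_cols M $ i = M $$ (i mod dim_row M, i div dim_row M)"
  by (simp add: stack_cols_eq)

lemma dim_kron [simp]:
  "dim_row (A \<otimes>\<^sub>K B) = dim_row A * dim_row B" "dim_col (A \<otimes>\<^sub>K B) = dim_col A * dim_col B"
  by (simp_all add: kron_def)

lemma mod_div_less_mult:
  fixes i r c :: nat
  assumes "i < r * c"
  shows "i mod r < r" "i div r < c"
proof -
  have "0 < r" using assms by (auto intro: Nat.gr0I)
  then show "i mod r < r" by simp
  show "i div r < c" using assms by (simp add: less_mult_imp_div_less mult.commute)
qed

text \<open>The classical rule for vec(AXB). Stacking puts entry \<open>(j mod q, j div q)\<close>
  of \<open>X\<close> at position \<open>j\<close>, and the Kronecker product splits its column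
  index \<open>j\<close> in the same way, so the flat sum is the double sum of the triple product.
  With one factor an identity matrix, it covers every Kronecker block of \<open>W\<close> and
  \<open>H\<^sub>2\<close>.\<close>

lemma kron_transpose_mult_stack_cols:
  assumes A: "A \<in> carrier_mat r q" and X: "X \<in> carrier_mat q s" and B: "B \<in> carrier_mat s c"
  shows "(transpose_mat B \<otimes>\<^sub>K A) *\<^sub>v stack_cols X = stack_cols (A * X * B)"
proof (intro eq_vecI)
  fix i assume "i < dim_vec (stack_cols (A * X * B))"
  then have i: "i < r * c" using A B by simp
  note im = mod_div_less_mult[OF i]
  have "((transpose_mat B \<otimes>\<^sub>K A) *\<^sub>v stack_cols X) $ i
      = (\<Sum>j<s * q. B $$ (j div q, i div r) * A $$ (i mod r, j mod q) * X $$ (j mod q, j div q))"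
  proof -
    have "((transpose_mat B \<otimes>\<^sub>K A) *\<^sub>v stack_cols X) $ i
      = (\<Sum>j<s * q. (transpose_mat B \<otimes>\<^sub>K A) $$ (i, j) * stack_cols X $ j)"
      using i A B X by (simp add: scalar_prod_def lessThan_atLeast0 mult.commute)
    also have "\<dots> = (\<Sum>j<s * q. B $$ (j div q, i div r) * A $$ (i mod r, j mod q)
        * X $$ (j mod q, j div q))"
    proof (rule sum.cong[OF refl])
      fix j assume "j \<in> {..<s * q}"
      then have j: "j < q * s" by (simp add: mult.commute)
      show "(transpose_mat B \<otimes>\<^sub>K A) $$ (i, j) * stack_cols X $ j
        = B $$ (j div q, i div r) * A $$ (i mod r, j mod q) * X $$ (j mod q, j div q)"
        using A B X i j im mod_div_less_mult[OF j]
        by (simp add: kron_def stack_cols_index mult.commute)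
    qed
    finally show ?thesis .
  qed
  also have "\<dots> = (\<Sum>x<s. \<Sum>y<q. B $$ (x, i div r) * A $$ (i mod r, y) * X $$ (y, x))"
    by (rule sum_div_mod)
  also have "\<dots> = (A * X * B) $$ (i mod r, i div r)"
    using A B X im
    by (subst sum.swap)
      (simp add: scalar_prod_def lessThan_atLeast0 sum_distrib_right sum_distrib_left mult_ac)
  also have "\<dots> = stack_cols (A * X * B) $ i"
    using A B i by (simp add: stack_cols_index)
  finally show "((transpose_mat B \<otimes>\<^sub>K A) *\<^sub>v stack_cols X) $ i = stack_cols (A * X * B) $ i" .
qed (use A B in \<open>auto simp: mult.commute\<close>)

lemma kron_one_mult_stack_cols:
  assumes A: "A \<in> carrier_mat r q" and X: "X \<in> carrier_mat q s"
  shows "(1\<^sub>m s \<otimes>\<^sub>K A) *\<^sub>v stack_cols X = stack_cols (A * X)"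
  using kron_transpose_mult_stack_cols[OF A X one_carrier_mat] A X by simp

lemma kron_transpose_one_mult_stack_cols:
  assumes X: "X \<in> carrier_mat q s" and B: "B \<in> carrier_mat s c"
  shows "(transpose_mat B \<otimes>\<^sub>K 1\<^sub>m q) *\<^sub>v stack_cols X = stack_cols (X * B)"
  using kron_transpose_mult_stack_cols[OF one_carrier_mat X B] X by simp

lemma stack_cols_minus:
  assumes "M \<in> carrier_mat r c" "M' \<in> carrier_mat r c"
  shows "stack_cols (M - M') = stack_cols M - stack_cols M'"
  using assms by (intro eq_vecI) (auto simp: stack_cols_index mod_div_less_mult)

section \<open>Concatenation and block diagonal matrices\<close>

text \<open>Has the form in which \<open>data_vec\<close> is written, while \<open>vcat_Cons\<close>
  provides the recursion for inductions.\<close>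

definition vcat :: "real vec list \<Rightarrow> real vec" where
  "vcat vs = vec_of_list (concat (map list_of_vec vs))"

lemma vcat_Nil: "vcat [] = vNil"
  by (simp add: vcat_def)

lemma vcat_Cons: "vcat (v # vs) = v @\<^sub>v vcat vs"
proof -
  have "vec_of_list (list_of_vec v @ xs) = v @\<^sub>v vec_of_list xs" for xs
    by (intro eq_vecI) (auto simp: vec_of_list_index nth_append)
  then show ?thesis by (simp add: vcat_def)
qed

lemma dim_vcat: "dim_vec (vcat vs) = (\<Sum>v\<leftarrow>vs. dim_vec v)"
  by (induction vs) (simp_all add: vcat_Nil vcat_Cons)

lemma vcat_uniform_index:
  assumes "\<And>v. v \<in> set vs \<Longrightarrow> dim_vec v = L" and "i < length vs * L"
  shows "vcat vs $ i = vs ! (i div L) $ (i mod L)"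
proof -
  have "i div L < length vs" "i mod L < L"
    using mod_div_less_mult[of i L "length vs"] assms(2) by (auto simp: mult.commute)
  moreover have "concat (map list_of_vec vs) ! i = map list_of_vec vs ! (i div L) ! (i mod L)"
    by (rule nth_concat_uniform) (use assms in auto)
  ultimately show ?thesis using assms by (simp add: vcat_def vec_of_list_index)
qed

lemma abs_vec_vcat: "abs_vec (vcat vs) = vcat (map abs_vec vs)"
proof (induction vs)
  case (Cons v vs)
  have "abs_vec (v @\<^sub>v w) = abs_vec v @\<^sub>v abs_vec w" for w
    by (intro eq_vecI) (auto simp: abs_vec_def)
  then show ?case using Cons by (simp add: vcat_Cons)
qed (simp add: vcat_Nil abs_vec_def, rule eq_vecI, auto)

section \<open>Horizontal concatenation: entries, products and absolute values\<close>

lemma dim_hcat [simp]: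
  "dim_row (hcat r Ms) = r" "dim_col (hcat r Ms) = (\<Sum>M\<leftarrow>Ms. dim_col M)"
  by (simp_all add: hcat_def length_concat o_def)

lemma hcat_Cons_index:
  assumes "i < r" "j < dim_col M + dim_col (hcat r Ms)" "dim_row M = r"
  shows "hcat r (M # Ms) $$ (i, j) = (if j < dim_col M then M $$ (i, j)
    else hcat r Ms $$ (i, j - dim_col M))"
  using assms by (auto simp: hcat_def mat_of_cols_index nth_append length_concat o_def)

lemma hcat_uniform_index:
  assumes "\<And>M. M \<in> set Ms \<Longrightarrow> M \<in> carrier_mat r c" and "i < r" and "j < length Ms * c"
  shows "hcat r Ms $$ (i, j) = Ms ! (j div c) $$ (i, j mod c)"
proof -
  have jj: "j div c < length Ms" "j mod c < c"
    using mod_div_less_mult[of j c "length Ms"] assms(3) by (auto simp: mult.commute)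
  then have "Ms ! (j div c) \<in> carrier_mat r c" using assms(1) by simp
  moreover have l: "length (concat (map cols Ms)) = length Ms * c"
    by (subst length_concat_uniform[of _ c]) (use assms(1) in fastforce)+
  moreover have "concat (map cols Ms) ! j = map cols Ms ! (j div c) ! (j mod c)"
    by (rule nth_concat_uniform) (use assms in fastforce)+
  ultimately show ?thesis
    using jj assms(2,3) by (simp add: hcat_def mat_of_cols_index)
qed

text \<open>Block row times block column. Blocks and segments are images of one common list, so a
  single hypothesis matches their sizes, and the induction peels off one pair by cutting the sum at
  the width of the first block.\<close>

lemma hcat_mult_vcat_index:
  assumes "\<And>x. x \<in> set xs \<Longrightarrow> f x \<in> carrier_mat r (dim_vec (g x))" and i: "i < r"
  shows "(hcat r (map f xs) *\<^sub>v vcat (map g xs)) $ i = (\<Sum>x\<leftarrow>xs. (f x *\<^sub>v g x) $ i)"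
  using assms(1)
proof (induction xs)
  case Nil
  then show ?case using i by (simp add: scalar_prod_def vcat_Nil)
next
  case (Cons x xs)
  let ?Ms = "map f xs" and ?v = "vcat (map g xs)"
  define b where "b = dim_vec (g x)"
  define d where "d = dim_vec ?v"
  have fx: "f x \<in> carrier_mat r b" using Cons.prems by (simp add: b_def)
  have "map dim_col ?Ms = map dim_vec (map g xs)"
    using Cons.prems by auto
  then have "(\<Sum>M\<leftarrow>?Ms. dim_col M) = (\<Sum>v\<leftarrow>map g xs. dim_vec v)"
    by (rule arg_cong)
  then have dc: "dim_col (hcat r ?Ms) = d" by (simp add: d_def dim_vcat)
  have dc': "dim_col (hcat r (f x # ?Ms)) = b + d" using dc fx by simp
  have "(hcat r (map f (x # xs)) *\<^sub>v vcat (map g (x # xs))) $ i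
      = (\<Sum>j\<in>{0..<b + d}. hcat r (f x # ?Ms) $$ (i, j) * (g x @\<^sub>v ?v) $ j)"
    using i dc' by (simp add: scalar_prod_def vcat_Cons b_def d_def del: dim_hcat(2))
  also have "\<dots> = (\<Sum>j\<in>{0..<b}. hcat r (f x # ?Ms) $$ (i, j) * (g x @\<^sub>v ?v) $ j)
      + (\<Sum>j\<in>{b..<b + d}. hcat r (f x # ?Ms) $$ (i, j) * (g x @\<^sub>v ?v) $ j)"
    by (simp add: sum.atLeastLessThan_concat)
  also have "(\<Sum>j\<in>{0..<b}. hcat r (f x # ?Ms) $$ (i, j) * (g x @\<^sub>v ?v) $ j) = (f x *\<^sub>v g x) $ i"
    using i fx dc
    by (simp add: scalar_prod_def b_def hcat_Cons_index del: dim_hcat(2))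
  also have "(\<Sum>j\<in>{b..<b + d}. hcat r (f x # ?Ms) $$ (i, j) * (g x @\<^sub>v ?v) $ j)
      = (\<Sum>j\<in>{0..<d}. hcat r ?Ms $$ (i, j) * ?v $ j)"
    using i fx dc
    by (subst sum.atLeastLessThan_shift_0)
      (simp add: b_def[symmetric] d_def[symmetric] hcat_Cons_index del: dim_hcat(2))
  also have "\<dots> = (hcat r ?Ms *\<^sub>v ?v) $ i"
    using i dc by (simp add: scalar_prod_def d_def del: dim_hcat(2))
  also have "\<dots> = (\<Sum>x\<leftarrow>xs. (f x *\<^sub>v g x) $ i)"
    by (rule Cons.IH) (use Cons.prems in auto)
  finally show ?case by simp
qed

text \<open>Left multiplication acts on each column separately. Together with
  \<open>abs_mat_hcat\<close> this splits the absolute value of a product by blocks, although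
  absolute values do not commute with products.\<close>

lemma mult_hcat:
  assumes V: "V \<in> carrier_mat s r" and Ms: "\<And>M. M \<in> set Ms \<Longrightarrow> dim_row M = r"
  shows "V * hcat r Ms = hcat s (map (\<lambda>M. V * M) Ms)"
  using Ms
proof (induction Ms)
  case Nil
  show ?case using V by (intro eq_matI) auto
next
  case (Cons M Ms)
  show ?case
  proof (intro eq_matI)
    fix i j assume "i < dim_row (hcat s (map (\<lambda>M. V * M) (M # Ms)))"
      and "j < dim_col (hcat s (map (\<lambda>M. V * M) (M # Ms)))"
    then have i: "i < s" and j: "j < dim_col M + dim_col (hcat r Ms)"
      by (simp_all add: o_def)
    have M: "dim_row M = r" using Cons.prems by simp
    have IH: "V * hcat r Ms = hcat s (map (\<lambda>M. V * M) Ms)" using Cons by simp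
    have "(V * hcat r (M # Ms)) $$ (i, j) = (\<Sum>l\<in>{0..<r}. V $$ (i, l) * hcat r (M # Ms) $$ (l, j))"
      using i j V by (simp add: scalar_prod_def)
    also have "\<dots> = (\<Sum>l\<in>{0..<r}. V $$ (i, l) * (if j < dim_col M then M $$ (l, j)
        else hcat r Ms $$ (l, j - dim_col M)))"
      by (intro sum.cong refl) (use j M in \<open>auto simp: hcat_Cons_index simp del: dim_hcat(2)\<close>)
    also have "\<dots> = (if j < dim_col M then (V * M) $$ (i, j)
        else (V * hcat r Ms) $$ (i, j - dim_col M))"
      using i j V M by (simp add: scalar_prod_def)
    also have "\<dots> = hcat s (map (\<lambda>M. V * M) (M # Ms)) $$ (i, j)"
      using i j V by (simp add: IH hcat_Cons_index o_def)
    finally show "(V * hcat r (M # Ms)) $$ (i, j) = hcat s (map (\<lambda>M. V * M) (M # Ms)) $$ (i, j)" .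
  qed (use V in \<open>auto simp: o_def\<close>)
qed

lemma abs_mat_hcat:
  assumes "\<And>M. M \<in> set Ms \<Longrightarrow> dim_row M = r"
  shows "abs_mat (hcat r Ms) = hcat r (map abs_mat Ms)"
  using assms
proof (induction Ms)
  case Nil
  show ?case by (intro eq_matI) (auto simp: abs_mat_def)
next
  case (Cons M Ms)
  have IH: "abs_mat (hcat r Ms) = hcat r (map abs_mat Ms)" using Cons by simp
  show ?case
  proof (intro eq_matI)
    fix i j assume "i < dim_row (hcat r (map abs_mat (M # Ms)))"
      and "j < dim_col (hcat r (map abs_mat (M # Ms)))"
    then have ij: "i < r" "j < dim_col M + dim_col (hcat r Ms)"
      by (simp_all add: o_def abs_mat_def)
    have "hcat r (map abs_mat (M # Ms)) $$ (i, j)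
      = (if j < dim_col M then abs_mat M $$ (i, j) else abs_mat (hcat r Ms) $$ (i, j - dim_col M))"
      using ij Cons.prems IH[symmetric] by (simp add: hcat_Cons_index abs_mat_def o_def)
    also have "\<dots> = abs_mat (hcat r (M # Ms)) $$ (i, j)"
      using ij Cons.prems by (simp add: abs_mat_def hcat_Cons_index)
    finally show "abs_mat (hcat r (M # Ms)) $$ (i, j) = hcat r (map abs_mat (M # Ms)) $$ (i, j)"
      by simp
  qed (auto simp: abs_mat_def o_def)
qed

section \<open>Block diagonal matrices with blocks of equal size\<close>

lemma diag_block_mat_uniform:
  assumes "\<And>M. M \<in> set Ms \<Longrightarrow> M \<in> carrier_mat r c"
  shows "diag_block_mat Ms \<in> carrier_mat (length Ms * r) (length Ms * c)"
  using assms by (induction Ms) (auto simp: Let_def)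

lemma diag_block_mat_uniform_index:
  assumes "\<And>M. M \<in> set Ms \<Longrightarrow> M \<in> carrier_mat r c"
    and "i < length Ms * r" and "j < length Ms * c"
  shows "diag_block_mat Ms $$ (i, j)
    = (if i div r = j div c then Ms ! (i div r) $$ (i mod r, j mod c) else 0)"
  using assms
proof (induction Ms arbitrary: i j)
  case (Cons M Ms)
  have M: "M \<in> carrier_mat r c" and Ms: "\<And>M. M \<in> set Ms \<Longrightarrow> M \<in> carrier_mat r c"
    using Cons.prems by auto
  have pos: "0 < r" "0 < c" using Cons.prems by (auto intro: Nat.gr0I)
  have d: "diag_block_mat Ms \<in> carrier_mat (length Ms * r) (length Ms * c)"
    by (rule diag_block_mat_uniform[OF Ms])
  have D: "diag_block_mat (M # Ms) = four_block_mat M (0\<^sub>m r (length Ms * c))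
      (0\<^sub>m (length Ms * r) c) (diag_block_mat Ms)"
    using M d by (simp add: Let_def)
  have IH: "diag_block_mat Ms $$ (i - r, j - c) = (if (i - r) div r = (j - c) div c
      then Ms ! ((i - r) div r) $$ ((i - r) mod r, (j - c) mod c) else 0)"
    if "r \<le> i" "c \<le> j"
    by (rule Cons.IH[OF Ms]) (use that Cons.prems(2,3) in auto)
  have ij: "i < r + length Ms * r" "j < c + length Ms * c" using Cons.prems(2,3) by auto
  show ?case
  proof (cases "i < r"; cases "j < c")
    assume "i < r" "j < c"
    then show ?thesis using M d ij pos by (simp add: D)
  next
    assume "i < r" "\<not> j < c"
    then show ?thesis using M d ij pos by (simp add: D le_div_geq)
  next
    assume "\<not> i < r" "j < c"
    then show ?thesis using M d ij pos by (simp add: D le_div_geq)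
  next
    assume "\<not> i < r" "\<not> j < c"
    then show ?thesis using M d ij pos IH by (simp add: D le_div_geq le_mod_geq)
  qed
qed simp

section \<open>The data vector\<close>

definition data_block :: "(nat \<Rightarrow> real mat) \<Rightarrow> (nat \<Rightarrow> real mat) \<Rightarrow> (nat \<Rightarrow> real mat) \<Rightarrow>
    (nat \<Rightarrow> real mat) \<Rightarrow> (nat \<Rightarrow> real mat) \<Rightarrow> (nat \<Rightarrow> real mat) \<Rightarrow> nat \<Rightarrow> real vec" where
  "data_block A B C D E F k = vcat (map stack_cols [A k, B k, E k, C k, D k, F k])"

text \<open>Length of one segment of the data vector; \<open>p\<close> segments make up the
  dimension 2p(m^2 + n^2 + mn) of the data space.\<close>

definition block_dim :: "nat \<Rightarrow> nat \<Rightarrow> nat" where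
  "block_dim m n = 2 * (m * m + n * n + m * n)"

lemma data_vec_eq: "data_vec p A B C D E F = vcat (map (data_block A B C D E F) [1..<Suc p])"
  by (simp add: data_vec_def vcat_def data_block_def list_vec o_def)

lemma pgcs_coeffsD:
  assumes "pgcs_coeffs p m n A B C D E F" and "k \<in> {1..p}"
  shows "A k \<in> carrier_mat m m" "B k \<in> carrier_mat n n" "E k \<in> carrier_mat m n"
    "C k \<in> carrier_mat m m" "D k \<in> carrier_mat n n" "F k \<in> carrier_mat m n"
  using assms by (auto simp: pgcs_coeffs_def)

lemma dim_data_block:
  assumes "pgcs_coeffs p m n A B C D E F" and "k \<in> {1..p}"
  shows "dim_vec (data_block A B C D E F k) = block_dim m n"
proof -
  note c = pgcs_coeffsD[OF assms, THEN carrier_matD(1)] pgcs_coeffsD[OF assms, THEN carrier_matD(2)]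
  show ?thesis by (simp add: data_block_def dim_vcat c block_dim_def)
qed

lemma dim_data_vec:
  assumes "pgcs_coeffs p m n A B C D E F"
  shows "dim_vec (data_vec p A B C D E F) = p * block_dim m n"
proof -
  have "map (dim_vec \<circ> data_block A B C D E F) [1..<Suc p] = map (\<lambda>_. block_dim m n) [1..<Suc p]"
    using dim_data_block[OF assms] by (intro map_cong) auto
  then show ?thesis
    unfolding data_vec_eq dim_vcat map_map by (simp only:) (simp add: sum_list_triv)
qed

lemma data_vec_index:
  assumes c: "pgcs_coeffs p m n A B C D E F" and i: "i < p * block_dim m n"
  shows "data_vec p A B C D E F $ i
    = data_block A B C D E F (i div block_dim m n + 1) $ (i mod block_dim m n)"
proof -
  have "i div block_dim m n < p"
    using mod_div_less_mult(2)[of i "block_dim m n" p] i by (simp add: mult.commute)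
  then show ?thesis
    unfolding data_vec_eq using i dim_data_block[OF c]
    by (subst vcat_uniform_index[where L = "block_dim m n"]) (auto simp del: upt_Suc)
qed

lemma vcat_append_index:
  "l < dim_vec v \<Longrightarrow> vcat (us @ v # ws) $ ((\<Sum>u\<leftarrow>us. dim_vec u) + l) = v $ l"
proof (induction us)
  case (Cons u us)
  then show ?case by (simp add: vcat_Cons dim_vcat)
qed (simp add: vcat_Cons)

text \<open>The offsets are the partial sums of the six lengths. They are written exactly as in the
  abbreviations \<open>coeff_A\<close> to \<open>coeff_F\<close>, including the \<open>0 +\<close>
  of the first, so that all six cases fit the pattern \<open>off + l\<close>.\<close>

lemma data_block_index:
  assumes c: "pgcs_coeffs p m n A B C D E F" and k: "k \<in> {1..p}"
  defines "v \<equiv> data_block A B C D E F k"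
  shows "l < m * m \<Longrightarrow> v $ (0 + l) = stack_cols (A k) $ l"
    "l < n * n \<Longrightarrow> v $ (m * m + l) = stack_cols (B k) $ l"
    "l < m * n \<Longrightarrow> v $ (m * m + n * n + l) = stack_cols (E k) $ l"
    "l < m * m \<Longrightarrow> v $ (m * m + n * n + m * n + l) = stack_cols (C k) $ l"
    "l < n * n \<Longrightarrow> v $ (2 * (m * m) + n * n + m * n + l) = stack_cols (D k) $ l"
    "l < m * n \<Longrightarrow> v $ (2 * (m * m) + 2 * (n * n) + m * n + l) = stack_cols (F k) $ l"
proof -
  note c = pgcs_coeffsD[OF c k, THEN carrier_matD(1)] pgcs_coeffsD[OF c k, THEN carrier_matD(2)]
  define s where "s M = stack_cols (M k)" for M :: "nat \<Rightarrow> real mat"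
  have d: "dim_vec (s A) = m * m" "dim_vec (s B) = n * n" "dim_vec (s E) = m * n"
    "dim_vec (s C) = m * m" "dim_vec (s D) = n * n" "dim_vec (s F) = m * n"
    by (simp_all add: s_def c)
  have v: "v = vcat [s A, s B, s E, s C, s D, s F]"
    by (simp add: v_def data_block_def s_def)
  have sum4: "(\<Sum>u\<leftarrow>[s A, s B, s E, s C]. dim_vec u) = 2 * (m * m) + n * n + m * n"
    and sum5: "(\<Sum>u\<leftarrow>[s A, s B, s E, s C, s D]. dim_vec u) = 2 * (m * m) + 2 * (n * n) + m * n"
    by (simp_all add: d)
  show "l < m * m \<Longrightarrow> v $ (0 + l) = stack_cols (A k) $ l"
    using vcat_append_index[of l "s A" "[]"] unfolding v by (simp add: d s_def[symmetric])
  show "l < n * n \<Longrightarrow> v $ (m * m + l) = stack_cols (B k) $ l"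
    using vcat_append_index[of l "s B" "[s A]"] unfolding v by (simp add: d s_def[symmetric])
  show "l < m * n \<Longrightarrow> v $ (m * m + n * n + l) = stack_cols (E k) $ l"
    using vcat_append_index[of l "s E" "[s A, s B]"] unfolding v
    by (simp add: d s_def[symmetric] ac_simps)
  show "l < m * m \<Longrightarrow> v $ (m * m + n * n + m * n + l) = stack_cols (C k) $ l"
    using vcat_append_index[of l "s C" "[s A, s B, s E]"] unfolding v
    by (simp add: d s_def[symmetric] ac_simps)
  show "l < n * n \<Longrightarrow> v $ (2 * (m * m) + n * n + m * n + l) = stack_cols (D k) $ l"
    using vcat_append_index[of l "s D" "[s A, s B, s E, s C]" "[s F]"]
    by (simp only: sum4) (simp add: v d s_def[symmetric])
  show "l < m * n \<Longrightarrow> v $ (2 * (m * m) + 2 * (n * n) + m * n + l) = stack_cols (F k) $ l"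
    using vcat_append_index[of l "s F" "[s A, s B, s E, s C, s D]" "[]"]
    by (simp only: sum5) (simp add: v d s_def[symmetric])
qed

text \<open>The inverse of \<open>data_vec\<close>: the \<open>r \<times> c\<close> matrix stored column by column
  at offset \<open>off\<close> of the \<open>k\<close>-th segment of the data vector.\<close>

definition read_mat :: "nat \<Rightarrow> nat \<Rightarrow> nat \<Rightarrow> nat \<Rightarrow> nat \<Rightarrow> real vec \<Rightarrow> nat \<Rightarrow> real mat" where
  "read_mat m n r c off x k
    = mat r c (\<lambda>(i, j). x $ ((k - 1) * block_dim m n + (off + (j * r + i))))"

abbreviation "coeff_A m n \<equiv> read_mat m n m m 0"
abbreviation "coeff_B m n \<equiv> read_mat m n n n (m * m)"
abbreviation "coeff_E m n \<equiv> read_mat m n m n (m * m + n * n)"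
abbreviation "coeff_C m n \<equiv> read_mat m n m m (m * m + n * n + m * n)"
abbreviation "coeff_D m n \<equiv> read_mat m n n n (2 * (m * m) + n * n + m * n)"
abbreviation "coeff_F m n \<equiv> read_mat m n m n (2 * (m * m) + 2 * (n * n) + m * n)"

lemma read_mat_carrier [simp]: "read_mat m n r c off x k \<in> carrier_mat r c"
  by (simp add: read_mat_def)

lemma dim_read_mat [simp]:
  "dim_row (read_mat m n r c off x k) = r" "dim_col (read_mat m n r c off x k) = c"
  by (simp_all add: read_mat_def)

lemma col_major_less: "i < r \<Longrightarrow> j < c \<Longrightarrow> j * r + i < r * (c::nat)"
  by (metis add.commute mult.commute mult_Suc_right nat_add_left_cancel_less
      order_less_le_trans Suc_leI mult_le_mono2)

lemma stack_cols_col_major_index: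
  assumes M: "M \<in> carrier_mat r c" and "i < r" "j < c"
  shows "stack_cols M $ (j * r + i) = M $$ (i, j)"
  using assms col_major_less[of i r j c] by (simp add: stack_cols_index)

text \<open>Injectivity of \<open>data_vec\<close> on families of the right shape, for the indices
  \<open>1, ..., p\<close>. Hence \<open>W\<close> and the right-hand side are functions of the data
  vector.\<close>

lemma read_mat_data_vec:
  assumes c: "pgcs_coeffs p m n A B C D E F" and k: "k \<in> {1..p}"
  defines "t \<equiv> data_vec p A B C D E F"
  shows "coeff_A m n t k = A k" "coeff_B m n t k = B k" "coeff_E m n t k = E k"
    "coeff_C m n t k = C k" "coeff_D m n t k = D k" "coeff_F m n t k = F k"
proof -
  note d = pgcs_coeffsD[OF c k]
  have t: "t $ ((k - 1) * block_dim m n + l) = data_block A B C D E F k $ l"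
    if l: "l < block_dim m n" for l
  proof -
    have "(k - 1) * block_dim m n + l < Suc (k - 1) * block_dim m n" using l by simp
    also have "\<dots> \<le> p * block_dim m n" using k by (intro mult_le_mono1) simp
    finally have "t $ ((k - 1) * block_dim m n + l)
      = data_block A B C D E F (((k - 1) * block_dim m n + l) div block_dim m n + 1)
          $ (((k - 1) * block_dim m n + l) mod block_dim m n)"
      unfolding t_def by (rule data_vec_index[OF c])
    moreover have "((k - 1) * K + l) div K = k - 1" "((k - 1) * K + l) mod K = l"
      if "l < K" for K using that by auto
    moreover have "k - 1 + 1 = k" using k by simp
    ultimately show ?thesis using l by metis
  qed
  have read: "read_mat m n r s off t k = M"
    if M: "M \<in> carrier_mat r s" and off: "off + r * s \<le> block_dim m n"
      and eq: "\<And>l. l < r * s \<Longrightarrow> data_block A B C D E F k $ (off + l) = stack_cols M $ l" for r s off M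
  proof (rule eq_matI)
    fix i j assume "i < dim_row M" "j < dim_col M"
    then have ij: "i < r" "j < s" using M by auto
    note l = col_major_less[OF ij]
    have "read_mat m n r s off t k $$ (i, j) = data_block A B C D E F k $ (off + (j * r + i))"
      using ij l off by (simp only: read_mat_def index_mat prod.case) (rule t, simp)
    also have "\<dots> = M $$ (i, j)" using eq[OF l] stack_cols_col_major_index[OF M ij] by simp
    finally show "read_mat m n r s off t k $$ (i, j) = M $$ (i, j)" .
  qed (use M in \<open>auto simp: read_mat_def\<close>)
  show "coeff_A m n t k = A k" "coeff_B m n t k = B k" "coeff_E m n t k = E k"
    "coeff_C m n t k = C k" "coeff_D m n t k = D k" "coeff_F m n t k = F k"
    by (rule read[OF d(1) _ data_block_index(1)[OF c k]] read[OF d(2) _ data_block_index(2)[OF c k]]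
          read[OF d(3) _ data_block_index(3)[OF c k]] read[OF d(4) _ data_block_index(4)[OF c k]]
          read[OF d(5) _ data_block_index(5)[OF c k]] read[OF d(6) _ data_block_index(6)[OF c k]];
        simp add: block_dim_def)+
qed

lemma pgcs_coeffs_read_mat:
  "pgcs_coeffs p m n (coeff_A m n x) (coeff_B m n x) (coeff_C m n x) (coeff_D m n x)
     (coeff_E m n x) (coeff_F m n x)"
  by (simp add: pgcs_coeffs_def)

text \<open>Surjectivity of \<open>data_vec\<close>: every vector of the right length is a data
  vector, which leaves nonsingularity of \<open>W\<close> as the only restriction in the
  domain.\<close>

lemma data_vec_read_mat:
  assumes x: "x \<in> carrier_vec (p * block_dim m n)"
  shows "data_vec p (coeff_A m n x) (coeff_B m n x) (coeff_C m n x) (coeff_D m n x)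
     (coeff_E m n x) (coeff_F m n x) = x"
    (is "data_vec p ?A ?B ?C ?D ?E ?F = x")
proof (rule eq_vecI)
  note c = pgcs_coeffs_read_mat[of p m n x]
  show "dim_vec (data_vec p ?A ?B ?C ?D ?E ?F) = dim_vec x" using dim_data_vec[OF c] x by simp
  fix i assume "i < dim_vec x"
  then have i: "i < p * block_dim m n" using x by simp
  define k where "k = i div block_dim m n + 1"
  define l where "l = i mod block_dim m n"
  have k: "k \<in> {1..p}" and l: "l < block_dim m n"
    using mod_div_less_mult[of i "block_dim m n" p] i
    by (simp_all add: k_def l_def mult.commute)
  have il: "(k - 1) * block_dim m n + l = i"
    unfolding k_def l_def add_diff_cancel_right' by (rule div_mult_mod_eq)
  have piece: "data_block ?A ?B ?C ?D ?E ?F k $ l = x $ i"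
    if eq: "\<And>l. l < r * s \<Longrightarrow> data_block ?A ?B ?C ?D ?E ?F k $ (off + l)
        = stack_cols (read_mat m n r s off x k) $ l"
      and l': "off \<le> l" "l < off + r * s" for r s off
  proof -
    have l'': "l - off < r * s" using l' by linarith
    have "data_block ?A ?B ?C ?D ?E ?F k $ l = stack_cols (read_mat m n r s off x k) $ (l - off)"
      using eq[OF l''] l' by simp
    also have "\<dots> = x $ ((k - 1) * block_dim m n + (off + (l - off)))"
      using l'' mod_div_less_mult[OF l''] by (simp add: stack_cols_index read_mat_def)
    finally show ?thesis using l' il by simp
  qed
  \<comment> \<open>The six consecutive intervals cover the whole block. The products of dimensions
    are replaced by variables, which leaves linear arithmetic.\<close>
  have segments: "l < a \<or> a \<le> l \<and> l < a + b \<or> a + b \<le> l \<and> l < a + b + e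
      \<or> a + b + e \<le> l \<and> l < a + b + e + a \<or> 2 * a + b + e \<le> l \<and> l < 2 * a + b + e + b
      \<or> 2 * a + 2 * b + e \<le> l \<and> l < 2 * a + 2 * b + e + e"
    if "l < 2 * (a + b + e)" for a b e :: nat
    using that by (cases "l < a"; cases "l < a + b"; cases "l < a + b + e"; cases "l < 2 * a + b + e";
        cases "l < 2 * a + 2 * b + e") simp_all
  have "l < 2 * (m * m + n * n + m * n)" using l by (simp only: block_dim_def)
  then have "l < m * m \<or> m * m \<le> l \<and> l < m * m + n * n
    \<or> m * m + n * n \<le> l \<and> l < m * m + n * n + m * n
    \<or> m * m + n * n + m * n \<le> l \<and> l < m * m + n * n + m * n + m * m
    \<or> 2 * (m * m) + n * n + m * n \<le> l \<and> l < 2 * (m * m) + n * n + m * n + n * n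
    \<or> 2 * (m * m) + 2 * (n * n) + m * n \<le> l \<and> l < 2 * (m * m) + 2 * (n * n) + m * n + m * n"
    by (rule segments)
  then have "data_block ?A ?B ?C ?D ?E ?F k $ l = x $ i"
  proof (elim disjE)
    assume "l < m * m" then show ?thesis using piece[OF data_block_index(1)[OF c k]] by simp
  next
    assume "m * m \<le> l \<and> l < m * m + n * n"
    then show ?thesis using piece[OF data_block_index(2)[OF c k]] by blast
  next
    assume "m * m + n * n \<le> l \<and> l < m * m + n * n + m * n"
    then show ?thesis using piece[OF data_block_index(3)[OF c k]] by blast
  next
    assume "m * m + n * n + m * n \<le> l \<and> l < m * m + n * n + m * n + m * m"
    then show ?thesis using piece[OF data_block_index(4)[OF c k]] by blast
  next
    assume "2 * (m * m) + n * n + m * n \<le> l \<and> l < 2 * (m * m) + n * n + m * n + n * n"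
    then show ?thesis using piece[OF data_block_index(5)[OF c k]] by blast
  next
    assume "2 * (m * m) + 2 * (n * n) + m * n \<le> l
      \<and> l < 2 * (m * m) + 2 * (n * n) + m * n + m * n"
    then show ?thesis using piece[OF data_block_index(6)[OF c k]] by blast
  qed
  moreover have "data_vec p ?A ?B ?C ?D ?E ?F $ i = data_block ?A ?B ?C ?D ?E ?F k $ l"
    unfolding k_def l_def by (rule data_vec_index[OF c i])
  ultimately show "data_vec p ?A ?B ?C ?D ?E ?F $ i = x $ i" by simp
qed

section \<open>The coefficient matrix\<close>

lemma nth_interleave_list:
  assumes "s < 2 * p"
  shows "concat (map (\<lambda>k. [X k, Y k]) [1..<Suc p]) ! s = (if even s then X else Y) (s div 2 + 1)"
proof -
  have "concat (map (\<lambda>k. [X k, Y k]) [1..<Suc p]) ! s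
      = map (\<lambda>k. [X k, Y k]) [1..<Suc p] ! (s div 2) ! (s mod 2)"
    by (rule nth_concat_uniform) (use assms in auto)
  also have "\<dots> = [X (s div 2 + 1), Y (s div 2 + 1)] ! (s mod 2)"
  proof -
    have "s div 2 < length [1..<Suc p]" "[1..<Suc p] ! (s div 2) = s div 2 + 1"
      using assms by (auto simp del: upt_Suc)
    then show ?thesis by (subst nth_map) simp_all
  qed
  finally show ?thesis by (auto simp: even_iff_mod_2_eq_zero odd_iff_mod_2_eq_one)
qed

lemma interleave_carrier:
  assumes "\<forall>k\<in>{1..p}. X k \<in> carrier_mat m n \<and> Y k \<in> carrier_mat m n"
  shows "interleave p m X Y \<in> carrier_mat m (2 * p * n)"
proof -
  have "dim_col (X k) + dim_col (Y k) = 2 * n" if "k \<in> {1..p}" for k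
    using bspec[OF assms that] by auto
  then have "map (\<lambda>k. dim_col (X k) + dim_col (Y k)) [1..<Suc p] = map (\<lambda>_. 2 * n) [1..<Suc p]"
    by (intro map_cong) auto
  moreover have "(\<Sum>M\<leftarrow>concat (map (\<lambda>k. [X k, Y k]) ks). dim_col M)
      = (\<Sum>k\<leftarrow>ks. dim_col (X k) + dim_col (Y k))" for ks :: "nat list"
    by (induction ks) auto
  ultimately have "(\<Sum>M\<leftarrow>concat (map (\<lambda>k. [X k, Y k]) [1..<Suc p]). dim_col M) = p * (2 * n)"
    by (simp only:) (simp add: sum_list_triv)
  then show ?thesis by (intro carrier_matI) (simp_all add: interleave_def del: upt_Suc)
qed

text \<open>Stacking columns turns horizontal concatenation into concatenation of stacked blocks.
  The matrix entry is addressed by splitting with \<open>m\<close> and then with \<open>n\<close>,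
  the block by splitting with \<open>m * n\<close>; the rules for division by a product reconcile
  the two. Blocks count from 0 here, so the even ones belong to \<open>X\<close>.\<close>

lemma stack_cols_interleave_index:
  assumes XY: "\<forall>k\<in>{1..p}. X k \<in> carrier_mat m n \<and> Y k \<in> carrier_mat m n"
    and i: "i < 2 * p * m * n"
  shows "stack_cols (interleave p m X Y) $ i
    = stack_cols ((if even (i div (m * n)) then X else Y) (i div (m * n) div 2 + 1)) $ (i mod (m * n))"
proof -
  let ?L = "concat (map (\<lambda>k. [X k, Y k]) [1..<Suc p])"
  define s where "s = i div (m * n)"
  have i': "i < m * (2 * p * n)" "i < (m * n) * (2 * p)" using i by (simp_all add: mult_ac)
  have s: "s < 2 * p" and l: "i mod (m * n) < m * n"
    using mod_div_less_mult[OF i'(2)] by (simp_all add: s_def)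
  let ?M = "(if even s then X else Y) (s div 2 + 1)"
  have M: "?M \<in> carrier_mat m n" using XY s by auto
  have "stack_cols (interleave p m X Y) $ i = interleave p m X Y $$ (i mod m, i div m)"
    using interleave_carrier[OF XY] i' by (subst stack_cols_index) auto
  also have "\<dots> = ?L ! (i div m div n) $$ (i mod m, i div m mod n)"
    unfolding interleave_def
  proof (rule hcat_uniform_index)
    have "length ?L = p * 2" by (subst length_concat_uniform[of _ 2]) auto
    then show "i div m < length ?L * n" using mod_div_less_mult(2)[OF i'(1)] by (simp add: mult_ac)
  qed (use XY mod_div_less_mult(1)[OF i'(1)] in auto)
  also have "\<dots> = ?M $$ (i mod m, i div m mod n)"
    using nth_interleave_list[OF s, of X Y] by (simp add: s_def div_mult2_eq)
  also have "\<dots> = stack_cols ?M $ (i mod (m * n))"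
  proof -
    have "0 < m" using i by (auto intro: Nat.gr0I)
    then have "i mod (m * n) mod m = i mod m" "i mod (m * n) div m = i div m mod n"
      by (simp_all add: mod_mult2_eq)
    then show ?thesis using M l by (simp add: stack_cols_index)
  qed
  finally show ?thesis by (simp add: s_def)
qed

section \<open>The blocks of \<open>W\<close> and its product with the stacked unknowns\<close>

lemma W_mat_carrier: "W_mat p m n A B C D \<in> carrier_mat (2 * p * m * n) (2 * p * m * n)"
  by (simp add: W_mat_def)

lemma W_block_carrier:
  assumes c: "pgcs_coeffs p m n A B C D E F" and r: "r < 2 * p"
  shows "W_block p m n A B C D (r + 1) s \<in> carrier_mat (m * n) (m * n)"
proof -
  have "(r + 1 + 1) div 2 \<in> {1..p}" using r by auto
  from pgcs_coeffsD[OF c this] show ?thesis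
    by (auto simp: W_block_def Let_def mult.commute)
qed

text \<open>\<open>W_block\<close> counts from 1, while \<open>q\<close> and \<open>s\<close> count
  from 0 as quotients of flat indices do; the equation index is \<open>q + 1\<close>.\<close>

lemma W_block_odd_row:
  "W_block p m n A B C D (2 * q + 1) (s + 1) =
    (if s = 2 * q then 1\<^sub>m n \<otimes>\<^sub>K A (q + 1)
     else if s = 2 * q + 1 then - (transpose_mat (B (q + 1)) \<otimes>\<^sub>K 1\<^sub>m m)
     else 0\<^sub>m (m * n) (m * n))"
proof -
  have "(2 * q + 1 + 1) div 2 = q + 1" by simp
  then show ?thesis by (simp add: W_block_def)
qed

text \<open>\<open>2 * ((q + 1) mod p)\<close> is the position, counted from 0, of the block column
  belonging to \<open>X\<close> at the cyclic successor of \<open>q + 1\<close>; it is 0 when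
  \<open>q + 1 = p\<close>.\<close>

lemma W_block_even_row:
  "W_block p m n A B C D (2 * q + 1 + 1) (s + 1) =
    (if s = 2 * q + 1 then - (transpose_mat (D (q + 1)) \<otimes>\<^sub>K 1\<^sub>m m)
     else if s = 2 * ((q + 1) mod p) then 1\<^sub>m n \<otimes>\<^sub>K C (q + 1)
     else 0\<^sub>m (m * n) (m * n))"
proof -
  have k: "(2 * q + 1 + 1 + 1) div 2 = q + 1" by simp
  show ?thesis
    unfolding W_block_def Let_def k by simp
qed

lemma sum_two_points:
  fixes a b :: real and x y N :: nat
  assumes "x < N" "y < N" "x \<noteq> y"
  shows "(\<Sum>s<N. if s = x then a else if s = y then b else 0) = a + b"
proof -
  have "(\<Sum>s<N. if s = x then a else if s = y then b else 0)
      = (\<Sum>s<N. (if s = x then a else 0) + (if s = y then b else 0))"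
    by (intro sum.cong) (use assms in auto)
  also have "\<dots> = a + b" using assms by (simp add: sum.distrib)
  finally show ?thesis .
qed

lemma W_mat_mult_index:
  assumes c: "pgcs_coeffs p m n A B C D E F"
    and XY: "\<forall>k\<in>{1..p}. X k \<in> carrier_mat m n \<and> Y k \<in> carrier_mat m n"
    and i: "i < 2 * p * m * n"
  shows "(W_mat p m n A B C D *\<^sub>v stack_cols (interleave p m X Y)) $ i
    = (\<Sum>s<2 * p. (W_block p m n A B C D (i div (m * n) + 1) (s + 1)
        *\<^sub>v stack_cols ((if even s then X else Y) (s div 2 + 1))) $ (i mod (m * n)))"
proof -
  let ?z = "\<lambda>s. stack_cols ((if even s then X else Y) (s div 2 + 1))"
  let ?W = "\<lambda>s. W_block p m n A B C D (i div (m * n) + 1) (s + 1)"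
  have i': "i < (m * n) * (2 * p)" using i by (simp add: mult_ac)
  note im = mod_div_less_mult[OF i']
  have "(W_mat p m n A B C D *\<^sub>v stack_cols (interleave p m X Y)) $ i
      = (\<Sum>j<(2 * p) * (m * n). ?W (j div (m * n)) $$ (i mod (m * n), j mod (m * n))
          * ?z (j div (m * n)) $ (j mod (m * n)))"
  proof -
    have "dim_vec (stack_cols (interleave p m X Y)) = 2 * p * m * n"
      using interleave_carrier[OF XY] by simp
    then have "(W_mat p m n A B C D *\<^sub>v stack_cols (interleave p m X Y)) $ i
      = (\<Sum>j<2 * p * m * n. W_mat p m n A B C D $$ (i, j) * stack_cols (interleave p m X Y) $ j)"
      using i W_mat_carrier[of p m n A B C D]
      by (simp add: scalar_prod_def lessThan_atLeast0 del: dim_stack_cols)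
    also have "\<dots> = (\<Sum>j<2 * p * m * n. ?W (j div (m * n)) $$ (i mod (m * n), j mod (m * n))
          * ?z (j div (m * n)) $ (j mod (m * n)))"
      by (intro sum.cong refl) (use i in \<open>simp add: W_mat_def stack_cols_interleave_index[OF XY]\<close>)
    finally show ?thesis by (simp add: mult.assoc)
  qed
  also have "\<dots> = (\<Sum>s<2 * p. \<Sum>l<m * n. ?W s $$ (i mod (m * n), l) * ?z s $ l)"
    by (rule sum_div_mod)
  also have "\<dots> = (\<Sum>s<2 * p. (?W s *\<^sub>v ?z s) $ (i mod (m * n)))"
  proof (rule sum.cong[OF refl])
    fix s assume "s \<in> {..<2 * p}"
    then have "s div 2 + 1 \<in> {1..p}" by auto
    then have "(if even s then X else Y) (s div 2 + 1) \<in> carrier_mat m n" using XY by auto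
    moreover have "?W s \<in> carrier_mat (m * n) (m * n)" by (rule W_block_carrier[OF c im(2)])
    ultimately show "(\<Sum>l<m * n. ?W s $$ (i mod (m * n), l) * ?z s $ l)
      = (?W s *\<^sub>v ?z s) $ (i mod (m * n))"
      using im by (simp add: scalar_prod_def lessThan_atLeast0)
  qed
  finally show ?thesis .
qed

text \<open>The check that \<open>W\<close> represents the left-hand sides. Every block row has two
  nonzero blocks, so the sum over block columns has two terms, and each is a Kronecker
  identity.\<close>

lemma W_mat_mult_stack_cols:
  assumes c: "pgcs_coeffs p m n A B C D E F"
    and XY: "\<forall>k\<in>{1..p}. X k \<in> carrier_mat m n \<and> Y k \<in> carrier_mat m n"
  shows "W_mat p m n A B C D *\<^sub>v stack_cols (interleave p m X Y)
    = stack_cols (interleave p m (\<lambda>k. A k * X k - Y k * B k) (\<lambda>k. C k * X (k mod p + 1) - Y k * D k))"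
    (is "_ = stack_cols (interleave p m ?R ?S)")
proof (rule eq_vecI)
  have succ: "k mod p + 1 \<in> {1..p}" if "k \<in> {1..p}" for k
    using that by (auto simp: Suc_le_eq)
  have "?R k \<in> carrier_mat m n \<and> ?S k \<in> carrier_mat m n" if "k \<in> {1..p}" for k
    using bspec[OF XY that] bspec[OF XY succ[OF that]] pgcs_coeffsD[OF c that] by auto
  then have RS: "\<forall>k\<in>{1..p}. ?R k \<in> carrier_mat m n \<and> ?S k \<in> carrier_mat m n" by blast
  note RSc = interleave_carrier[OF RS]
  show "dim_vec (W_mat p m n A B C D *\<^sub>v stack_cols (interleave p m X Y))
      = dim_vec (stack_cols (interleave p m ?R ?S))"
    using RSc W_mat_carrier[of p m n A B C D] by (simp del: One_nat_def)
  fix i assume "i < dim_vec (stack_cols (interleave p m ?R ?S))"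
  then have i: "i < 2 * p * m * n" using RSc by (simp add: mult_ac)
  then have i': "i < (m * n) * (2 * p)" by (simp add: mult_ac)
  define r where "r = i div (m * n)"
  define l where "l = i mod (m * n)"
  have r: "r < 2 * p" and l: "l < m * n"
    using mod_div_less_mult[OF i'] by (simp_all add: r_def l_def)
  let ?z = "\<lambda>s. stack_cols ((if even s then X else Y) (s div 2 + 1))"
  have z: "dim_vec (?z s) = m * n" if "s < 2 * p" for s
  proof -
    have "s div 2 + 1 \<in> {1..p}" using that by auto
    from bspec[OF XY this] show ?thesis by auto
  qed
  define q where "q = r div 2"
  have q: "q + 1 \<in> {1..p}" using r by (auto simp: q_def)
  note d = pgcs_coeffsD[OF c q]
  have XYq: "X (q + 1) \<in> carrier_mat m n" "Y (q + 1) \<in> carrier_mat m n"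
      "X ((q + 1) mod p + 1) \<in> carrier_mat m n"
    using bspec[OF XY q] bspec[OF XY succ[OF q]] by auto
  have stack_minus: "stack_cols (M - M') $ l = stack_cols M $ l - stack_cols M' $ l"
    if "M \<in> carrier_mat m n" "M' \<in> carrier_mat m n" for M M'
    using that l by (subst stack_cols_minus[OF that]) simp
  have "(W_mat p m n A B C D *\<^sub>v stack_cols (interleave p m X Y)) $ i
      = (\<Sum>s<2 * p. (W_block p m n A B C D (r + 1) (s + 1) *\<^sub>v ?z s) $ l)"
    unfolding r_def l_def by (rule W_mat_mult_index[OF c XY i])
  also have "\<dots> = stack_cols ((if even r then ?R else ?S) (q + 1)) $ l"
  proof (cases "even r")
    case True
    then have rq: "r = 2 * q" by (simp add: q_def)
    have "(\<Sum>s<2 * p. (W_block p m n A B C D (r + 1) (s + 1) *\<^sub>v ?z s) $ l)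
      = (\<Sum>s<2 * p. if s = 2 * q then ((1\<^sub>m n \<otimes>\<^sub>K A (q + 1)) *\<^sub>v stack_cols (X (q + 1))) $ l
          else if s = 2 * q + 1
          then ((- (transpose_mat (B (q + 1)) \<otimes>\<^sub>K 1\<^sub>m m)) *\<^sub>v stack_cols (Y (q + 1))) $ l
          else 0)"
      unfolding rq W_block_odd_row
      by (intro sum.cong refl) (use z l in \<open>auto simp: scalar_prod_def\<close>)
    also have "\<dots> = ((1\<^sub>m n \<otimes>\<^sub>K A (q + 1)) *\<^sub>v stack_cols (X (q + 1))) $ l
        + ((- (transpose_mat (B (q + 1)) \<otimes>\<^sub>K 1\<^sub>m m)) *\<^sub>v stack_cols (Y (q + 1))) $ l"
      by (rule sum_two_points) (use q in auto)
    also have "\<dots> = stack_cols (?R (q + 1)) $ l"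
      using d XYq l
      by (simp add: stack_minus kron_one_mult_stack_cols kron_transpose_one_mult_stack_cols mult.commute)
    finally show ?thesis using True by simp
  next
    case False
    then have rq: "r = 2 * q + 1" by (simp add: q_def)
    have x: "(q + 1) mod p < p" using q by simp
    have "(\<Sum>s<2 * p. (W_block p m n A B C D (r + 1) (s + 1) *\<^sub>v ?z s) $ l)
      = (\<Sum>s<2 * p. if s = 2 * q + 1
          then ((- (transpose_mat (D (q + 1)) \<otimes>\<^sub>K 1\<^sub>m m)) *\<^sub>v stack_cols (Y (q + 1))) $ l
          else if s = 2 * ((q + 1) mod p)
          then ((1\<^sub>m n \<otimes>\<^sub>K C (q + 1)) *\<^sub>v stack_cols (X ((q + 1) mod p + 1))) $ l else 0)"
      unfolding rq W_block_even_row
      by (intro sum.cong refl) (use z l in \<open>auto simp: scalar_prod_def\<close>)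
    also have "\<dots> = ((- (transpose_mat (D (q + 1)) \<otimes>\<^sub>K 1\<^sub>m m)) *\<^sub>v stack_cols (Y (q + 1))) $ l
        + ((1\<^sub>m n \<otimes>\<^sub>K C (q + 1)) *\<^sub>v stack_cols (X ((q + 1) mod p + 1))) $ l"
    proof (rule sum_two_points)
      show "2 * q + 1 < 2 * p" "2 * ((q + 1) mod p) < 2 * p" using q x by auto
      \<comment> \<open>Parity keeps the two nonzero blocks in different block columns, also for
        \<open>p = 1\<close>, where the cyclic successor of an index is the index itself.\<close>
      have "2 * q + 1 \<noteq> 2 * y" for y :: nat by presburger
      then show "2 * q + 1 \<noteq> 2 * ((q + 1) mod p)" .
    qed
    also have "\<dots> = stack_cols (?S (q + 1)) $ l"
      using d XYq l
      by (simp add: stack_minus kron_one_mult_stack_cols kron_transpose_one_mult_stack_cols mult.commute)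
    finally show ?thesis using False by simp
  qed
  also have "\<dots> = stack_cols (interleave p m ?R ?S) $ i"
    unfolding r_def l_def q_def by (rule stack_cols_interleave_index[symmetric, OF RS i])
  finally show "(W_mat p m n A B C D *\<^sub>v stack_cols (interleave p m X Y)) $ i
    = stack_cols (interleave p m ?R ?S) $ i" .
qed

text \<open>Families read back from a data vector agree with the original ones only on
  \<open>1, ..., p\<close>; this lemma and \<open>interleave_cong\<close> make that agreement
  sufficient.\<close>

lemma W_mat_cong:
  assumes "\<And>k. k \<in> {1..p} \<Longrightarrow> A k = A' k \<and> B k = B' k \<and> C k = C' k \<and> D k = D' k"
  shows "W_mat p m n A B C D = W_mat p m n A' B' C' D'"
proof (rule eq_matI)
  fix i j assume "i < dim_row (W_mat p m n A' B' C' D')" "j < dim_col (W_mat p m n A' B' C' D')"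
  then have ij: "i < 2 * p * m * n" "j < 2 * p * m * n" by (simp_all add: W_mat_def)
  then have "i < (m * n) * (2 * p)" by (simp add: mult_ac)
  from mod_div_less_mult(2)[OF this] have "(i div (m * n) + 1 + 1) div 2 \<in> {1..p}" by auto
  from assms[OF this] show "W_mat p m n A B C D $$ (i, j) = W_mat p m n A' B' C' D' $$ (i, j)"
    using ij by (simp add: W_mat_def W_block_def Let_def)
qed (simp_all add: W_mat_def)

lemma interleave_cong:
  assumes "\<And>k. k \<in> {1..p} \<Longrightarrow> X k = X' k \<and> Y k = Y' k"
  shows "interleave p m X Y = interleave p m X' Y'"
proof -
  have "map (\<lambda>k. [X k, Y k]) [1..<Suc p] = map (\<lambda>k. [X' k, Y' k]) [1..<Suc p]"
    using assms by (intro map_cong) auto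
  then show ?thesis unfolding interleave_def by (rule arg_cong)
qed

section \<open>The matrix \<open>H\<^sub>2\<close>\<close>

lemma P_mat_mult_index:
  assumes M: "M \<in> carrier_mat (m * n) c" and i: "i < 2 * p * m * n" and j: "j \<in> {1..2 * p}"
    and l: "l < c"
  shows "(P_mat p m n j * M) $$ (i, l)
    = (if i div (m * n) = j - 1 then M $$ (i mod (m * n), l) else 0)"
proof -
  have pos: "0 < m * n" using i by (auto intro!: Nat.gr0I)
  have bound: "(j - 1) * (m * n) + y < 2 * p * m * n" if "y < m * n" for y
  proof -
    have "(j - 1) * (m * n) + y < (m * n) * (2 * p)"
      by (rule col_major_less) (use that j in auto)
    then show ?thesis by (simp add: mult_ac)
  qed
  have "(P_mat p m n j * M) $$ (i, l) = (\<Sum>y<m * n. P_mat p m n j $$ (i, y) * M $$ (y, l))"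
    using M i l by (simp add: P_mat_def scalar_prod_def lessThan_atLeast0)
  also have "\<dots> = (\<Sum>y<m * n. if y = i mod (m * n)
      then (if i div (m * n) = j - 1 then M $$ (y, l) else 0) else 0)"
  proof (rule sum.cong[OF refl])
    fix y assume "y \<in> {..<m * n}"
    then have y: "y < m * n" by simp
    \<comment> \<open>Row \<open>i\<close> of \<open>P_mat p m n j\<close> has at most one nonzero
      entry, and it selects the summand with \<open>y = i mod (m * n)\<close>.\<close>
    have "(i = (j - 1) * (m * n) + y) = (i div (m * n) = j - 1 \<and> i mod (m * n) = y)"
    proof
      assume "i = (j - 1) * (m * n) + y"
      then show "i div (m * n) = j - 1 \<and> i mod (m * n) = y" using y pos by simp
    next
      assume "i div (m * n) = j - 1 \<and> i mod (m * n) = y"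
      then show "i = (j - 1) * (m * n) + y" using div_mult_mod_eq[of i "m * n"] by simp
    qed
    then show "P_mat p m n j $$ (i, y) * M $$ (y, l)
      = (if y = i mod (m * n) then (if i div (m * n) = j - 1 then M $$ (y, l) else 0) else 0)"
      using y i bound[OF y] by (auto simp: P_mat_def)
  qed
  also have "\<dots> = (if i div (m * n) = j - 1 then M $$ (i mod (m * n), l) else 0)"
    using pos by (simp add: sum.delta)
  finally show ?thesis .
qed

lemma P_mat_carrier: "P_mat p m n j \<in> carrier_mat (2 * p * m * n) (m * n)"
  by (simp add: P_mat_def)

lemma P_mat_mult_vec_index:
  assumes M: "M \<in> carrier_mat (m * n) c" and v: "v \<in> carrier_vec c"
    and i: "i < 2 * p * m * n" and j: "j \<in> {1..2 * p}"
  shows "((P_mat p m n j * M) *\<^sub>v v) $ i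
    = (if i div (m * n) = j - 1 then (M *\<^sub>v v) $ (i mod (m * n)) else 0)"
proof -
  have "i mod (m * n) < m * n"
    by (rule mod_div_less_mult(1)[of _ _ "2 * p"]) (use i in \<open>simp add: mult_ac\<close>)
  have "((P_mat p m n j * M) *\<^sub>v v) $ i = (\<Sum>l<c. (P_mat p m n j * M) $$ (i, l) * v $ l)"
    using M v i P_mat_carrier[of p m n j]
    by (simp add: scalar_prod_def lessThan_atLeast0 del: assoc_mult_mat_vec)
  also have "\<dots> = (\<Sum>l<c. (if i div (m * n) = j - 1 then M $$ (i mod (m * n), l) else 0) * v $ l)"
    by (intro sum.cong refl) (simp add: P_mat_mult_index[OF M i j])
  also have "\<dots> = (if i div (m * n) = j - 1 then (M *\<^sub>v v) $ (i mod (m * n)) else 0)"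
    using M v \<open>i mod (m * n) < m * n\<close> by (simp add: scalar_prod_def lessThan_atLeast0)
  finally show ?thesis .
qed

lemma append_rows_index:
  assumes A: "A \<in> carrier_mat r c" and B: "B \<in> carrier_mat r' c" and "i < r + r'" "j < c"
  shows "(A @\<^sub>r B) $$ (i, j) = (if i < r then A $$ (i, j) else B $$ (i - r, j))"
  using assms by (auto simp: append_rows_def)

text \<open>Multiplication by \<open>P_mat p m n j\<close> moves a block to block row \<open>j\<close>, which turns the
  block diagonal matrix into a horizontal concatenation.\<close>

definition H2_cols :: "nat \<Rightarrow> nat \<Rightarrow> nat \<Rightarrow> (nat \<Rightarrow> real mat) \<Rightarrow> (nat \<Rightarrow> real mat) \<Rightarrow> nat \<Rightarrow> real mat" where
  "H2_cols p m n X Y k = hcat (2 * p * m * n)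
    [P_mat p m n (2 * k - 1) * (transpose_mat (X k) \<otimes>\<^sub>K 1\<^sub>m m),
     P_mat p m n (2 * k - 1) * (- (1\<^sub>m n \<otimes>\<^sub>K Y k)),
     P_mat p m n (2 * k - 1) * (- 1\<^sub>m (m * n)),
     P_mat p m n (2 * k) * (transpose_mat (X (k mod p + 1)) \<otimes>\<^sub>K 1\<^sub>m m),
     P_mat p m n (2 * k) * (- (1\<^sub>m n \<otimes>\<^sub>K Y k)),
     P_mat p m n (2 * k) * (- 1\<^sub>m (m * n))]"

lemma hcat_mult_vcat6_index:
  assumes "M1 \<in> carrier_mat r (dim_vec v1)" "M2 \<in> carrier_mat r (dim_vec v2)"
    "M3 \<in> carrier_mat r (dim_vec v3)" "M4 \<in> carrier_mat r (dim_vec v4)"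
    "M5 \<in> carrier_mat r (dim_vec v5)" "M6 \<in> carrier_mat r (dim_vec v6)" and "i < r"
  shows "(hcat r [M1, M2, M3, M4, M5, M6] *\<^sub>v vcat [v1, v2, v3, v4, v5, v6]) $ i
    = (M1 *\<^sub>v v1) $ i + (M2 *\<^sub>v v2) $ i + (M3 *\<^sub>v v3) $ i
      + (M4 *\<^sub>v v4) $ i + (M5 *\<^sub>v v5) $ i + (M6 *\<^sub>v v6) $ i"
proof -
  let ?xs = "[(M1, v1), (M2, v2), (M3, v3), (M4, v4), (M5, v5), (M6, v6)]"
  have "(hcat r (map fst ?xs) *\<^sub>v vcat (map snd ?xs)) $ i = (\<Sum>x\<leftarrow>?xs. (fst x *\<^sub>v snd x) $ i)"
    by (rule hcat_mult_vcat_index) (use assms in auto)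
  then show ?thesis by (simp only: list.map fst_conv snd_conv sum_list.Cons sum_list.Nil add_0_right add.assoc)
qed

lemma cyclic_succ: "k \<in> {1..p} \<Longrightarrow> k mod p + 1 \<in> {1..p::nat}"
  by (auto simp: Suc_le_eq)

lemma piece_carriers:
  fixes X Y :: "nat \<Rightarrow> real mat"
  assumes XY: "\<forall>k\<in>{1..p}. X k \<in> carrier_mat m n \<and> Y k \<in> carrier_mat m n" and k: "k \<in> {1..p}"
  shows "transpose_mat (X k) \<otimes>\<^sub>K 1\<^sub>m m \<in> carrier_mat (m * n) (m * m)"
    "1\<^sub>m n \<otimes>\<^sub>K Y k \<in> carrier_mat (m * n) (n * n)"
    "transpose_mat (X (k mod p + 1)) \<otimes>\<^sub>K 1\<^sub>m m \<in> carrier_mat (m * n) (m * m)"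
  using bspec[OF XY k] bspec[OF XY cyclic_succ[OF k]] by (auto simp: mult.commute)

lemma H2_block_carrier:
  assumes XY: "\<forall>k\<in>{1..p}. X k \<in> carrier_mat m n \<and> Y k \<in> carrier_mat m n" and k: "k \<in> {1..p}"
  shows "H2_block p m n X Y k \<in> carrier_mat (2 * (m * n)) (block_dim m n)"
proof -
  note c = piece_carriers[OF XY k] bspec[OF XY k] bspec[OF XY cyclic_succ[OF k]]
  have "H2_block p m n X Y k \<in> carrier_mat (m * n + m * n) (block_dim m n)"
    unfolding H2_block_def
    by (rule carrier_append_rows) (use c in \<open>auto simp: block_dim_def intro!: carrier_matI\<close>)
  then show ?thesis by (simp add: mult_2)
qed

lemma H2_cols_carrier:
  assumes XY: "\<forall>k\<in>{1..p}. X k \<in> carrier_mat m n \<and> Y k \<in> carrier_mat m n" and k: "k \<in> {1..p}"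
  shows "H2_cols p m n X Y k \<in> carrier_mat (2 * p * m * n) (block_dim m n)"
  using bspec[OF XY k] bspec[OF XY cyclic_succ[OF k]]
  by (auto simp: H2_cols_def block_dim_def intro!: carrier_matI)

text \<open>The piece \<open>s\<close> and the column \<open>l\<close> inside it are fixed by
  \<open>j\<close> and the widths alone, before any matrices are chosen. One pair therefore locates
  column \<open>j\<close> in every list with these widths, as the comparison of
  \<open>H2_cols\<close> with both halves of \<open>H2_block\<close> requires.\<close>

lemma hcat_piece_index:
  assumes "j < sum_list ws"
  obtains s l where "s < length ws" and "l < ws ! s"
    and "\<And>Ms r i. map dim_col Ms = ws \<Longrightarrow> \<forall>M\<in>set Ms. dim_row M = r \<Longrightarrow> i < r \<Longrightarrow>
      hcat r Ms $$ (i, j) = Ms ! s $$ (i, l)"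
  using assms
proof (induction ws arbitrary: j thesis)
  case (Cons w ws)
  show thesis
  proof (cases "j < w")
    case True
    show thesis
    proof (rule Cons.prems(1)[of 0 j])
      fix Ms :: "real mat list" and r i
      assume "map dim_col Ms = w # ws" "\<forall>M\<in>set Ms. dim_row M = r" "i < r"
      then show "hcat r Ms $$ (i, j) = Ms ! 0 $$ (i, j)"
        using True by (auto simp: map_eq_Cons_conv hcat_Cons_index)
    qed (use True in auto)
  next
    case False
    then have "j - w < sum_list ws" using Cons.prems(2) by simp
    then obtain s l where sl: "s < length ws" "l < ws ! s"
      and h: "\<And>Ms r i. map dim_col Ms = ws \<Longrightarrow> \<forall>M\<in>set Ms. dim_row M = r \<Longrightarrow> i < r \<Longrightarrow>
        hcat r Ms $$ (i, j - w) = Ms ! s $$ (i, l)"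
      using Cons.IH by blast
    show thesis
    proof (rule Cons.prems(1)[of "Suc s" l])
      fix Ms :: "real mat list" and r i
      assume "map dim_col Ms = w # ws" "\<forall>M\<in>set Ms. dim_row M = r" "i < r"
      then show "hcat r Ms $$ (i, j) = Ms ! Suc s $$ (i, l)"
        using False Cons.prems(2) h by (auto simp: map_eq_Cons_conv hcat_Cons_index)
    qed (use sl in auto)
  qed
qed simp

text \<open>The diagonal blocks of \<open>H\<^sub>2\<close> have height \<open>2 * q\<close>, those
  placed by \<open>P_mat\<close> have height \<open>q\<close>: the upper half of pair
  \<open>k\<close> is block row \<open>2 * k - 1\<close>, the lower half is block row
  \<open>2 * k\<close>. The form \<open>2 * k - 1 - 1\<close> is \<open>j - 1\<close> at
  \<open>j = 2 * k - 1\<close>.\<close>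

lemma block_row_split:
  fixes i q k :: nat
  assumes "0 < q" and "1 \<le> k"
  shows "(i div q = 2 * k - 1 - 1) = (i div (2 * q) = k - 1 \<and> i mod (2 * q) < q)"
    "(i div q = 2 * k - 1) = (i div (2 * q) = k - 1 \<and> \<not> i mod (2 * q) < q)"
    "i mod (2 * q) < q \<Longrightarrow> i mod (2 * q) = i mod q"
    "\<not> i mod (2 * q) < q \<Longrightarrow> i mod (2 * q) - q = i mod q"
proof -
  define d where "d = i div q"
  have d: "i div (2 * q) = d div 2" "i mod (2 * q) = q * (d mod 2) + i mod q"
    unfolding d_def using div_mult2_eq[of i q 2] mod_mult2_eq[of i q 2] by (simp_all add: mult.commute)
  have lt: "(i mod (2 * q) < q) = (d mod 2 = 0)"
    using assms(1) unfolding d by (cases "d mod 2 = 0") (auto simp: odd_iff_mod_2_eq_one)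
  show "(i div q = 2 * k - 1 - 1) = (i div (2 * q) = k - 1 \<and> i mod (2 * q) < q)"
    "(i div q = 2 * k - 1) = (i div (2 * q) = k - 1 \<and> \<not> i mod (2 * q) < q)"
    unfolding lt unfolding d d_def[symmetric] using assms(2) by presburger+
  show "i mod (2 * q) < q \<Longrightarrow> i mod (2 * q) = i mod q"
    "\<not> i mod (2 * q) < q \<Longrightarrow> i mod (2 * q) - q = i mod q"
    unfolding lt unfolding d by (auto simp: odd_iff_mod_2_eq_one)
qed

lemma H2_cols_index:
  assumes XY: "\<forall>k\<in>{1..p}. X k \<in> carrier_mat m n \<and> Y k \<in> carrier_mat m n" and k: "k \<in> {1..p}"
    and i: "i < 2 * p * m * n" and j: "j < block_dim m n"
  shows "H2_cols p m n X Y k $$ (i, j) = (if i div (2 * (m * n)) = k - 1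
    then H2_block p m n X Y k $$ (i mod (2 * (m * n)), j) else 0)"
proof -
  define N where "N = 2 * p * m * n"
  define q where "q = m * n"
  define a where "a = m * m"
  define b where "b = n * n"
  define T1 where "T1 = transpose_mat (X k) \<otimes>\<^sub>K 1\<^sub>m m"
  define T2 where "T2 = - (1\<^sub>m n \<otimes>\<^sub>K Y k)"
  define T3 where "T3 = transpose_mat (X (k mod p + 1)) \<otimes>\<^sub>K 1\<^sub>m m"
  have c: "T1 \<in> carrier_mat q a" "T2 \<in> carrier_mat q b" "T3 \<in> carrier_mat q a"
    using piece_carriers[OF XY k] by (simp_all add: T1_def T2_def T3_def q_def a_def b_def)
  then have dc: "dim_row T1 = q" "dim_col T1 = a" "dim_row T2 = q" "dim_col T2 = b"
    "dim_row T3 = q" "dim_col T3 = a" by auto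
  have pos: "0 < q" using i by (auto simp: q_def intro!: Nat.gr0I)
  define P where "P j T = P_mat p m n j * T" for j and T :: "real mat"
  have dP: "dim_row (P j T) = N" "dim_col (P j T) = dim_col T" for j T
    by (simp_all add: P_def P_mat_def N_def)
  have P: "P j T $$ (i, l) = (if i div q = j - 1 then T $$ (i mod q, l) else 0)"
    if "T \<in> carrier_mat q c" "l < c" "j = 2 * k - 1 \<or> j = 2 * k" for j T l c
    unfolding P_def q_def
    by (rule P_mat_mult_index) (use that k i in \<open>auto simp: q_def\<close>)
  let ?Ms = "[P (2 * k - 1) T1, P (2 * k - 1) T2, P (2 * k - 1) (- 1\<^sub>m q),
    P (2 * k) T3, P (2 * k) T2, P (2 * k) (- 1\<^sub>m q)]"
  let ?Us = "[T1, T2, - 1\<^sub>m q, 0\<^sub>m q a, 0\<^sub>m q b, 0\<^sub>m q q]"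
  let ?Ls = "[0\<^sub>m q a, 0\<^sub>m q b, 0\<^sub>m q q, T3, T2, - 1\<^sub>m q]"
  let ?ws = "[a, b, q, a, b, q]"
  define i' where "i' = i mod (2 * q)"
  have i': "i' < q + q" using pos by (simp add: i'_def mult_2[symmetric])
  have "j < sum_list ?ws" using j by (simp add: block_dim_def a_def b_def q_def)
  then obtain s l where s: "s < length ?ws" and l: "l < ?ws ! s"
    and h: "\<And>Ms r i. map dim_col Ms = ?ws \<Longrightarrow> \<forall>M\<in>set Ms. dim_row M = r \<Longrightarrow> i < r \<Longrightarrow>
      hcat r Ms $$ (i, j) = Ms ! s $$ (i, l)"
    by (rule hcat_piece_index) blast
  have "H2_cols p m n X Y k $$ (i, j) = ?Ms ! s $$ (i, l)"
    unfolding H2_cols_def P_def[symmetric] N_def[symmetric]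
      T1_def[symmetric] T2_def[symmetric] T3_def[symmetric] q_def[symmetric]
    by (rule h) (use i in \<open>simp_all add: dP dc N_def\<close>)
  moreover have "H2_block p m n X Y k $$ (i', j)
    = (if i' < q then ?Us ! s $$ (i', l) else ?Ls ! s $$ (i' - q, l))"
  proof -
    have "H2_block p m n X Y k $$ (i', j)
      = (if i' < q then hcat q ?Us $$ (i', j) else hcat q ?Ls $$ (i' - q, j))"
      unfolding H2_block_def T1_def[symmetric] T2_def[symmetric] T3_def[symmetric] q_def[symmetric]
        a_def[symmetric] b_def[symmetric]
      by (rule append_rows_index[of _ _ "block_dim m n"])
        (use i' j in \<open>auto simp: dc block_dim_def a_def b_def q_def intro!: carrier_matI\<close>)
    also have "\<dots> = (if i' < q then ?Us ! s $$ (i', l) else ?Ls ! s $$ (i' - q, l))"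
    proof -
      have "hcat q ?Us $$ (i', j) = ?Us ! s $$ (i', l)" if "i' < q"
        by (rule h) (use that in \<open>simp_all add: dc\<close>)
      moreover have "hcat q ?Ls $$ (i' - q, j) = ?Ls ! s $$ (i' - q, l)" if "\<not> i' < q"
        by (rule h) (use that i' in \<open>simp_all add: dc\<close>)
      ultimately show ?thesis by simp
    qed
    finally show ?thesis .
  qed
  moreover have "?Ms ! s $$ (i, l) = (if i div (2 * q) = k - 1
      then if i' < q then ?Us ! s $$ (i', l) else ?Ls ! s $$ (i' - q, l) else 0)"
  proof -
    have k1: "1 \<le> k" using k by simp
    note split = block_row_split[OF pos k1, of i, folded i'_def]
    \<comment> \<open>The vanishing half is written as an entry of a zero block, so that the
      right-hand side matches the entries of \<open>?Us\<close> and \<open>?Ls\<close> literally;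
      likewise in \<open>low\<close>.\<close>
    have up: "P (2 * k - 1) T $$ (i, l) = (if i div (2 * q) = k - 1
        then if i' < q then T $$ (i', l) else 0\<^sub>m q c $$ (i' - q, l) else 0)"
      if T: "T \<in> carrier_mat q c" "l < c" for T c
    proof -
      have "i' - q < q" using i' by linarith
      then show ?thesis using P[OF T, of "2 * k - 1"] split T by auto
    qed
    have low: "P (2 * k) T $$ (i, l) = (if i div (2 * q) = k - 1
        then if i' < q then 0\<^sub>m q c $$ (i', l) else T $$ (i' - q, l) else 0)"
      if T: "T \<in> carrier_mat q c" "l < c" for T c
      using P[OF T, of "2 * k"] split T by auto
    have one: "- 1\<^sub>m q \<in> carrier_mat q q" by simp
    have "s = 0 \<or> s = 1 \<or> s = 2 \<or> s = 3 \<or> s = 4 \<or> s = 5" using s by auto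
    then show ?thesis
    proof (elim disjE)
      assume "s = 0" then show ?thesis using up[OF c(1)] l by simp
    next
      assume "s = 1" then show ?thesis using up[OF c(2)] l by simp
    next
      assume "s = 2" then show ?thesis using up[OF one] l by simp
    next
      assume "s = 3" then show ?thesis using low[OF c(3)] l by simp
    next
      assume "s = 4" then show ?thesis using low[OF c(2)] l by simp
    next
      assume "s = 5" then show ?thesis using low[OF one] l by simp
    qed
  qed
  ultimately show ?thesis by (simp add: i'_def q_def)
qed

text \<open>The columns of \<open>H\<^sub>2\<close> in segment \<open>k\<close> vanish outside the
  \<open>k\<close>-th pair of block rows, and this is the effect of the factors \<open>P_mat\<close>
  in \<open>H2_cols\<close>.\<close>

lemma H2_mat_eq_hcat:
  assumes XY: "\<forall>k\<in>{1..p}. X k \<in> carrier_mat m n \<and> Y k \<in> carrier_mat m n"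
  shows "H2_mat p m n X Y = hcat (2 * p * m * n) (map (H2_cols p m n X Y) [1..<Suc p])"
    and "H2_mat p m n X Y \<in> carrier_mat (2 * p * m * n) (p * block_dim m n)"
proof -
  let ?Bs = "map (H2_block p m n X Y) [1..<Suc p]" and ?Cs = "map (H2_cols p m n X Y) [1..<Suc p]"
  have B: "M \<in> carrier_mat (2 * (m * n)) (block_dim m n)" if "M \<in> set ?Bs" for M
    using that H2_block_carrier[OF XY] by (auto simp del: upt_Suc)
  have C: "M \<in> carrier_mat (2 * p * m * n) (block_dim m n)" if "M \<in> set ?Cs" for M
    using that H2_cols_carrier[OF XY] by (auto simp del: upt_Suc)
  have len: "length ?Bs = p" "length ?Cs = p" by simp_all
  have N: "p * (2 * (m * n)) = 2 * p * m * n" by simp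
  show H: "H2_mat p m n X Y \<in> carrier_mat (2 * p * m * n) (p * block_dim m n)"
    unfolding H2_mat_def using diag_block_mat_uniform[of ?Bs, OF B] by (simp only: len N)
  have "map dim_col ?Cs = map (\<lambda>_. block_dim m n) [1..<Suc p]"
    unfolding map_map by (rule map_cong) (use H2_cols_carrier[OF XY, THEN carrier_matD(2)] in auto)
  then have dC: "dim_col (hcat (2 * p * m * n) ?Cs) = p * block_dim m n"
    unfolding dim_hcat by (simp only:) (simp add: sum_list_triv)
  show "H2_mat p m n X Y = hcat (2 * p * m * n) ?Cs"
  proof (rule eq_matI)
    fix i j assume "i < dim_row (hcat (2 * p * m * n) ?Cs)" "j < dim_col (hcat (2 * p * m * n) ?Cs)"
    then have i: "i < 2 * p * m * n" and j: "j < p * block_dim m n"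
      by (simp_all only: dC dim_hcat(1))
    have i2: "i div (2 * (m * n)) < p"
      by (rule mod_div_less_mult(2)) (use i in \<open>simp add: mult_ac\<close>)
    have j2: "j div block_dim m n < p" "j mod block_dim m n < block_dim m n"
      using mod_div_less_mult[of j "block_dim m n" p] j by (simp_all add: mult.commute)
    have "H2_mat p m n X Y $$ (i, j) = (if i div (2 * (m * n)) = j div block_dim m n
        then ?Bs ! (i div (2 * (m * n))) $$ (i mod (2 * (m * n)), j mod block_dim m n) else 0)"
      unfolding H2_mat_def
      by (rule diag_block_mat_uniform_index[of ?Bs, OF B]) (simp_all only: len i j N)
    also have "\<dots> = H2_cols p m n X Y (j div block_dim m n + 1) $$ (i, j mod block_dim m n)"
      using j2 i2 by (subst H2_cols_index[OF XY _ i]) (auto simp del: upt_Suc)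
    also have "\<dots> = hcat (2 * p * m * n) ?Cs $$ (i, j)"
      using j2 by (subst hcat_uniform_index[of ?Cs, OF C i]) (simp_all add: j del: upt_Suc)
    finally show "H2_mat p m n X Y $$ (i, j) = hcat (2 * p * m * n) ?Cs $$ (i, j)" .
  qed (use H dC in \<open>simp_all del: upt_Suc dim_hcat(2)\<close>)
qed

lemma sum_list_indices: "(\<Sum>k\<leftarrow>[1..<Suc p]. f k) = (\<Sum>k\<in>{1..p}. f k :: real)"
  by (simp only: interv_sum_list_conv_sum_set_nat atLeastLessThanSuc_atLeastAtMost set_upt)

text \<open>The Kronecker identities with exchanged roles: here the coefficients \<open>A k\<close>,
  \<open>B k\<close>, \<open>C k\<close>, \<open>D k\<close> are the stacked matrices, and
  \<open>X\<close>, \<open>Y\<close> supply the Kronecker factors. Each half of the segment then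
  yields the residual of one of the two equations of index \<open>k\<close>.\<close>

lemma H2_cols_mult_index:
  assumes c: "pgcs_coeffs p m n A B C D E F"
    and XY: "\<forall>k\<in>{1..p}. X k \<in> carrier_mat m n \<and> Y k \<in> carrier_mat m n"
    and k: "k \<in> {1..p}" and i: "i < 2 * p * m * n"
  shows "(H2_cols p m n X Y k *\<^sub>v data_block A B C D E F k) $ i
    = (if k = i div (m * n) div 2 + 1
       then stack_cols (if even (i div (m * n)) then A k * X k - Y k * B k - E k
          else C k * X (k mod p + 1) - Y k * D k - F k) $ (i mod (m * n)) else 0)"
proof -
  define q where "q = m * n"
  define l where "l = i mod q"
  have lq: "l < q"
    unfolding l_def q_def by (rule mod_div_less_mult(1)[of _ _ "2 * p"]) (use i in \<open>simp add: mult_ac\<close>)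
  note d = pgcs_coeffsD[OF c k] bspec[OF XY k] bspec[OF XY cyclic_succ[OF k]]
  note pc = piece_carriers[OF XY k]
  have neg: "((- T) *\<^sub>v stack_cols M) $ l = - (T *\<^sub>v stack_cols M) $ l"
    if "T \<in> carrier_mat (m * n) (r * s)" "M \<in> carrier_mat r s" for T M r s
    using that lq by (simp add: q_def)
  have one: "((- 1\<^sub>m q) *\<^sub>v stack_cols M) $ l = - stack_cols M $ l" if M: "M \<in> carrier_mat m n" for M
    using neg[OF one_carrier_mat M] stack_cols_carrier[OF M] by (simp add: q_def)
  have diff: "stack_cols (M1 - M2 - M3) $ l = stack_cols M1 $ l - stack_cols M2 $ l - stack_cols M3 $ l"
    if M: "M1 \<in> carrier_mat m n" "M2 \<in> carrier_mat m n" "M3 \<in> carrier_mat m n" for M1 M2 M3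
    using lq M stack_cols_minus[OF M(1,2)] stack_cols_minus[OF minus_carrier_mat[OF M(2)] M(3), of M1]
    by (simp add: q_def)
  let ?P = "P_mat p m n"
  have "(H2_cols p m n X Y k *\<^sub>v data_block A B C D E F k) $ i
      = ((?P (2 * k - 1) * (transpose_mat (X k) \<otimes>\<^sub>K 1\<^sub>m m)) *\<^sub>v stack_cols (A k)) $ i
      + ((?P (2 * k - 1) * (- (1\<^sub>m n \<otimes>\<^sub>K Y k))) *\<^sub>v stack_cols (B k)) $ i
      + ((?P (2 * k - 1) * (- 1\<^sub>m (m * n))) *\<^sub>v stack_cols (E k)) $ i
      + ((?P (2 * k) * (transpose_mat (X (k mod p + 1)) \<otimes>\<^sub>K 1\<^sub>m m)) *\<^sub>v stack_cols (C k)) $ i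
      + ((?P (2 * k) * (- (1\<^sub>m n \<otimes>\<^sub>K Y k))) *\<^sub>v stack_cols (D k)) $ i
      + ((?P (2 * k) * (- 1\<^sub>m (m * n))) *\<^sub>v stack_cols (F k)) $ i"
    unfolding H2_cols_def data_block_def list.map
    by (rule hcat_mult_vcat6_index[OF _ _ _ _ _ _ i])
      (use d P_mat_carrier[of p m n, THEN carrier_matD(1)] in \<open>auto intro!: carrier_matI\<close>)
  also have "\<dots> = (if i div q = 2 * k - 1 - 1 then
        ((transpose_mat (X k) \<otimes>\<^sub>K 1\<^sub>m m) *\<^sub>v stack_cols (A k)) $ l
        + ((- (1\<^sub>m n \<otimes>\<^sub>K Y k)) *\<^sub>v stack_cols (B k)) $ l + ((- 1\<^sub>m q) *\<^sub>v stack_cols (E k)) $ l else 0)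
      + (if i div q = 2 * k - 1 then
        ((transpose_mat (X (k mod p + 1)) \<otimes>\<^sub>K 1\<^sub>m m) *\<^sub>v stack_cols (C k)) $ l
        + ((- (1\<^sub>m n \<otimes>\<^sub>K Y k)) *\<^sub>v stack_cols (D k)) $ l + ((- 1\<^sub>m q) *\<^sub>v stack_cols (F k)) $ l else 0)"
  proof -
    have e: "((P_mat p m n j * T) *\<^sub>v stack_cols M) $ i
        = (if i div q = j - 1 then (T *\<^sub>v stack_cols M) $ l else 0)"
      if "T \<in> carrier_mat (m * n) (r * s)" "M \<in> carrier_mat r s" "j = 2 * k - 1 \<or> j = 2 * k"
      for j T M r s
      unfolding q_def l_def
      by (rule P_mat_mult_vec_index[OF that(1) stack_cols_carrier[OF that(2)] i]) (use that k in auto)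
    have u: "- (1\<^sub>m n \<otimes>\<^sub>K Y k) \<in> carrier_mat (m * n) (n * n)" "- 1\<^sub>m (m * n) \<in> carrier_mat (m * n) (m * n)"
      using pc by simp_all
    show ?thesis
      unfolding
        e[OF pc(1) d(1) disjI1[OF refl]] e[OF u(1) d(2) disjI1[OF refl]] e[OF u(2) d(3) disjI1[OF refl]]
        e[OF pc(3) d(4) disjI2[OF refl]] e[OF u(1) d(5) disjI2[OF refl]] e[OF u(2) d(6) disjI2[OF refl]]
        q_def
      by simp
  qed
  also have "((transpose_mat (X k) \<otimes>\<^sub>K 1\<^sub>m m) *\<^sub>v stack_cols (A k)) $ l
        + ((- (1\<^sub>m n \<otimes>\<^sub>K Y k)) *\<^sub>v stack_cols (B k)) $ l + ((- 1\<^sub>m q) *\<^sub>v stack_cols (E k)) $ l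
      = stack_cols (A k * X k - Y k * B k - E k) $ l"
    unfolding neg[OF pc(2) d(2)] one[OF d(3)]
      kron_transpose_one_mult_stack_cols[OF d(1) d(7)[THEN conjunct1]]
      kron_one_mult_stack_cols[OF d(7)[THEN conjunct2] d(2)]
    by (subst diff) (use d in auto)
  also have "((transpose_mat (X (k mod p + 1)) \<otimes>\<^sub>K 1\<^sub>m m) *\<^sub>v stack_cols (C k)) $ l
        + ((- (1\<^sub>m n \<otimes>\<^sub>K Y k)) *\<^sub>v stack_cols (D k)) $ l + ((- 1\<^sub>m q) *\<^sub>v stack_cols (F k)) $ l
      = stack_cols (C k * X (k mod p + 1) - Y k * D k - F k) $ l"
    unfolding neg[OF pc(2) d(5)] one[OF d(6)]
      kron_transpose_one_mult_stack_cols[OF d(4) d(8)[THEN conjunct1]]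
      kron_one_mult_stack_cols[OF d(7)[THEN conjunct2] d(5)]
    by (subst diff) (use d in auto)
  \<comment> \<open>The two conditions exclude each other by parity, so the two conditionals merge
    into one.\<close>
  also have "(if i div q = 2 * k - 1 - 1 then stack_cols (A k * X k - Y k * B k - E k) $ l else 0)
      + (if i div q = 2 * k - 1 then stack_cols (C k * X (k mod p + 1) - Y k * D k - F k) $ l else 0)
      = (if k = i div q div 2 + 1
       then stack_cols (if even (i div q) then A k * X k - Y k * B k - E k
          else C k * X (k mod p + 1) - Y k * D k - F k) $ l else 0)"
  proof -
    have k1: "1 \<le> k" using k by simp
    have rows: "(r = 2 * k - 1 - 1) = (k = r div 2 + 1 \<and> even r)"
      "(r = 2 * k - 1) = (k = r div 2 + 1 \<and> odd r)" if "1 \<le> k" for r k :: nat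
      using that by presburger+
    show ?thesis unfolding rows[OF k1] by simp
  qed
  finally show ?thesis unfolding l_def q_def .
qed

text \<open>For fixed \<open>X\<close> and \<open>Y\<close> the residual is linear in the data, and
  \<open>H\<^sub>2\<close> is the matrix of this linear map. The data are arbitrary, so a perturbed
  equation can be tested with the unperturbed solution.\<close>

lemma H2_mat_mult_data_vec:
  assumes c: "pgcs_coeffs p m n A B C D E F"
    and XY: "\<forall>k\<in>{1..p}. X k \<in> carrier_mat m n \<and> Y k \<in> carrier_mat m n"
  shows "H2_mat p m n X Y *\<^sub>v data_vec p A B C D E F
    = W_mat p m n A B C D *\<^sub>v stack_cols (interleave p m X Y) - stack_cols (interleave p m E F)"
proof (rule eq_vecI)
  let ?R = "\<lambda>k. A k * X k - Y k * B k" and ?S = "\<lambda>k. C k * X (k mod p + 1) - Y k * D k"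
  have RS: "\<forall>k\<in>{1..p}. ?R k \<in> carrier_mat m n \<and> ?S k \<in> carrier_mat m n"
  proof
    fix k assume k: "k \<in> {1..p}"
    show "?R k \<in> carrier_mat m n \<and> ?S k \<in> carrier_mat m n"
      using pgcs_coeffsD[OF c k] bspec[OF XY k] bspec[OF XY cyclic_succ[OF k]] by auto
  qed
  have EF: "\<forall>k\<in>{1..p}. E k \<in> carrier_mat m n \<and> F k \<in> carrier_mat m n"
    using pgcs_coeffsD(3,6)[OF c] by blast
  note H = H2_mat_eq_hcat[OF XY]
  have dEF: "dim_vec (stack_cols (interleave p m E F)) = 2 * p * m * n"
    using interleave_carrier[OF EF] by simp
  then show "dim_vec (H2_mat p m n X Y *\<^sub>v data_vec p A B C D E F)
    = dim_vec (W_mat p m n A B C D *\<^sub>v stack_cols (interleave p m X Y) - stack_cols (interleave p m E F))"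
    using H(2) by (simp del: dim_stack_cols)
  fix i assume "i < dim_vec (W_mat p m n A B C D *\<^sub>v stack_cols (interleave p m X Y)
      - stack_cols (interleave p m E F))"
  then have i: "i < 2 * p * m * n" using dEF by (simp del: dim_stack_cols)
  then have i': "i < (m * n) * (2 * p)" by (simp add: mult_ac)
  define r where "r = i div (m * n)"
  define l where "l = i mod (m * n)"
  define k where "k = r div 2 + 1"
  have l: "l < m * n" and r: "r < 2 * p" using mod_div_less_mult[OF i'] by (simp_all add: r_def l_def)
  have k: "k \<in> {1..p}" using r by (auto simp: k_def)
  have "(H2_mat p m n X Y *\<^sub>v data_vec p A B C D E F) $ i
      = (\<Sum>k\<leftarrow>[1..<Suc p]. (H2_cols p m n X Y k *\<^sub>v data_block A B C D E F k) $ i)"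
    unfolding H(1) data_vec_eq
    by (rule hcat_mult_vcat_index[OF _ i])
      (use H2_cols_carrier[OF XY] dim_data_block[OF c] in \<open>auto simp del: upt_Suc\<close>)
  also have "\<dots> = (\<Sum>k\<in>{1..p}. (H2_cols p m n X Y k *\<^sub>v data_block A B C D E F k) $ i)"
    by (rule sum_list_indices)
  also have "\<dots> = (\<Sum>k'\<in>{1..p}. if k' = k then stack_cols (if even r then ?R k' - E k' else ?S k' - F k') $ l else 0)"
    by (intro sum.cong refl) (simp only: H2_cols_mult_index[OF c XY _ i] r_def l_def k_def)
  also have "\<dots> = stack_cols (if even r then ?R k - E k else ?S k - F k) $ l"
    using k by (simp add: sum.delta)
  also have "\<dots> = stack_cols ((if even r then ?R else ?S) k) $ l - stack_cols ((if even r then E else F) k) $ l"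
    using bspec[OF RS k] bspec[OF EF k] l stack_cols_minus[of _ m n] by (auto simp: stack_cols_minus)
  also have "\<dots> = stack_cols (interleave p m ?R ?S) $ i - stack_cols (interleave p m E F) $ i"
    unfolding r_def l_def k_def
    by (simp only: stack_cols_interleave_index[OF RS i] stack_cols_interleave_index[OF EF i])
  also have "\<dots> = (W_mat p m n A B C D *\<^sub>v stack_cols (interleave p m X Y)
      - stack_cols (interleave p m E F)) $ i"
    unfolding W_mat_mult_stack_cols[OF c XY] using i dEF by simp
  finally show "(H2_mat p m n X Y *\<^sub>v data_vec p A B C D E F) $ i
    = (W_mat p m n A B C D *\<^sub>v stack_cols (interleave p m X Y) - stack_cols (interleave p m E F)) $ i" .
qed

section \<open>Absolute values of block products and the vector \<open>omega\<close>\<close>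

lemma abs_mat_uminus: "abs_mat (- M) = abs_mat M"
  by (intro eq_matI) (auto simp: abs_mat_def)

lemma abs_mat_mult_hcat:
  assumes V: "V \<in> carrier_mat s r" and Ms: "\<forall>M\<in>set Ms. dim_row M = r"
  shows "abs_mat (V * hcat r Ms) = hcat s (map (\<lambda>M. abs_mat (V * M)) Ms)"
proof -
  have "abs_mat (V * hcat r Ms) = abs_mat (hcat s (map (\<lambda>M. V * M) Ms))"
    using mult_hcat[OF V, of Ms] Ms by simp
  also have "\<dots> = hcat s (map abs_mat (map (\<lambda>M. V * M) Ms))"
    by (rule abs_mat_hcat) (use V in auto)
  finally show ?thesis by (simp add: o_def)
qed

text \<open>Since \<open>H\<^sub>2\<close> is a row of blocks, the absolute value of its product
  with the inverse splits into the summands of \<open>omega\<close>. The minus signs in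
  \<open>H\<^sub>2\<close> vanish under absolute values, and its negative identity blocks leave just
  the inverse times \<open>P_mat\<close>.\<close>

lemma omega_eq:
  assumes c: "pgcs_coeffs p m n A B C D E F"
    and XY: "\<forall>k\<in>{1..p}. X k \<in> carrier_mat m n \<and> Y k \<in> carrier_mat m n"
    and W: "invertible_mat (W_mat p m n A B C D)"
  shows "omega p m n A B C D E F X Y
    = abs_mat (inv_mat (W_mat p m n A B C D) * H2_mat p m n X Y) *\<^sub>v abs_vec (data_vec p A B C D E F)"
proof -
  define N where "N = 2 * p * m * n"
  define V where "V = inv_mat (W_mat p m n A B C D)"
  have V: "V \<in> carrier_mat N N"
    unfolding V_def N_def by (rule inv_mat_inverts(1)[OF W_mat_carrier W])
  define P where "P = P_mat p m n"
  have P: "P j \<in> carrier_mat N (m * n)" for j by (simp add: P_def P_mat_carrier N_def)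
  define \<theta> where "\<theta> = (\<lambda>k.
         abs_mat (V * P (2 * k - 1) * (transpose_mat (X k) \<otimes>\<^sub>K 1\<^sub>m m)) *\<^sub>v abs_vec (stack_cols (A k))
       + abs_mat (V * P (2 * k - 1) * (1\<^sub>m n \<otimes>\<^sub>K Y k)) *\<^sub>v abs_vec (stack_cols (B k))
       + abs_mat (V * P (2 * k - 1)) *\<^sub>v abs_vec (stack_cols (E k))
       + abs_mat (V * P (2 * k) * (transpose_mat (X (k mod p + 1)) \<otimes>\<^sub>K 1\<^sub>m m)) *\<^sub>v abs_vec (stack_cols (C k))
       + abs_mat (V * P (2 * k) * (1\<^sub>m n \<otimes>\<^sub>K Y k)) *\<^sub>v abs_vec (stack_cols (D k))
       + abs_mat (V * P (2 * k)) *\<^sub>v abs_vec (stack_cols (F k)))"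
  have \<theta>: "\<theta> \<in> {1..p} \<rightarrow> carrier_vec N"
    using V by (auto simp: \<theta>_def abs_mat_def intro!: carrier_vecI)
  have om: "omega p m n A B C D E F X Y = finsum_vec TYPE(real) N \<theta> {1..p}"
    by (simp only: omega_def Let_def \<theta>_def V_def P_def N_def)
  have cols: "(abs_mat (V * H2_cols p m n X Y k) *\<^sub>v abs_vec (data_block A B C D E F k)) $ i = \<theta> k $ i"
    if k: "k \<in> {1..p}" and i: "i < N" for k i
  proof -
    note d = pgcs_coeffsD[OF c k] bspec[OF XY k] bspec[OF XY cyclic_succ[OF k]]
    note pc = piece_carriers[OF XY k]
    have "abs_mat (V * H2_cols p m n X Y k) = hcat N
      [abs_mat (V * (P (2 * k - 1) * (transpose_mat (X k) \<otimes>\<^sub>K 1\<^sub>m m))),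
       abs_mat (V * (P (2 * k - 1) * (- (1\<^sub>m n \<otimes>\<^sub>K Y k)))),
       abs_mat (V * (P (2 * k - 1) * (- 1\<^sub>m (m * n)))),
       abs_mat (V * (P (2 * k) * (transpose_mat (X (k mod p + 1)) \<otimes>\<^sub>K 1\<^sub>m m))),
       abs_mat (V * (P (2 * k) * (- (1\<^sub>m n \<otimes>\<^sub>K Y k)))),
       abs_mat (V * (P (2 * k) * (- 1\<^sub>m (m * n))))]" (is "_ = hcat N ?Ms")
      unfolding H2_cols_def N_def[symmetric] P_def[symmetric]
      by (subst abs_mat_mult_hcat[OF V]) (simp_all add: P[THEN carrier_matD(1)])
    moreover have "abs_vec (data_block A B C D E F k) = vcat [abs_vec (stack_cols (A k)),
        abs_vec (stack_cols (B k)), abs_vec (stack_cols (E k)), abs_vec (stack_cols (C k)),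
        abs_vec (stack_cols (D k)), abs_vec (stack_cols (F k))]" (is "_ = vcat ?vs")
      unfolding data_block_def abs_vec_vcat list.map ..
    ultimately have "(abs_mat (V * H2_cols p m n X Y k) *\<^sub>v abs_vec (data_block A B C D E F k)) $ i
      = (hcat N ?Ms *\<^sub>v vcat ?vs) $ i" by (simp only:)
    also have "\<dots> = (abs_mat (V * (P (2 * k - 1) * (transpose_mat (X k) \<otimes>\<^sub>K 1\<^sub>m m))) *\<^sub>v abs_vec (stack_cols (A k))) $ i
      + (abs_mat (V * (P (2 * k - 1) * (- (1\<^sub>m n \<otimes>\<^sub>K Y k)))) *\<^sub>v abs_vec (stack_cols (B k))) $ i
      + (abs_mat (V * (P (2 * k - 1) * (- 1\<^sub>m (m * n)))) *\<^sub>v abs_vec (stack_cols (E k))) $ i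
      + (abs_mat (V * (P (2 * k) * (transpose_mat (X (k mod p + 1)) \<otimes>\<^sub>K 1\<^sub>m m))) *\<^sub>v abs_vec (stack_cols (C k))) $ i
      + (abs_mat (V * (P (2 * k) * (- (1\<^sub>m n \<otimes>\<^sub>K Y k)))) *\<^sub>v abs_vec (stack_cols (D k))) $ i
      + (abs_mat (V * (P (2 * k) * (- 1\<^sub>m (m * n)))) *\<^sub>v abs_vec (stack_cols (F k))) $ i"
      by (rule hcat_mult_vcat6_index[OF _ _ _ _ _ _ i])
        (use d V in \<open>auto simp: abs_mat_def abs_vec_def intro!: carrier_matI\<close>)
    also have "\<dots> = \<theta> k $ i"
    proof -
      have neg: "abs_mat (V * (P j * - T)) = abs_mat (V * P j * T)" if T: "T \<in> carrier_mat (m * n) c" for j T c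
      proof -
        have "V * (P j * - T) = - (V * P j * T)"
          using V P[of j] T by (simp add: mult_minus_distrib_mat)
        then show ?thesis by (simp add: abs_mat_uminus)
      qed
      have pos: "V * (P j * T) = V * P j * T" if "T \<in> carrier_mat (m * n) c" for j T c
        using assoc_mult_mat[OF V P that] by simp
      have one: "abs_mat (V * (P j * - 1\<^sub>m (m * n))) = abs_mat (V * P j)" for j
        using neg[OF one_carrier_mat, of j] V P[of j] by simp
      show ?thesis
        unfolding
          neg[OF pc(2)] pos[OF pc(1)] pos[OF pc(3)] one \<theta>_def
        using i V by (simp add: abs_mat_def)
    qed
    finally show ?thesis .
  qed
  note H = H2_mat_eq_hcat[OF XY]
  let ?t = "data_vec p A B C D E F"
  have "abs_mat (V * H2_mat p m n X Y) = hcat N (map (\<lambda>k. abs_mat (V * H2_cols p m n X Y k)) [1..<Suc p])"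
    unfolding H(1) N_def[symmetric]
    by (subst abs_mat_mult_hcat[OF V])
      (use H2_cols_carrier[OF XY, THEN carrier_matD(1)] in \<open>auto simp: N_def o_def simp del: upt_Suc\<close>)
  moreover have "abs_vec ?t = vcat (map (\<lambda>k. abs_vec (data_block A B C D E F k)) [1..<Suc p])"
    by (simp add: data_vec_eq abs_vec_vcat o_def del: upt_Suc)
  ultimately have block_sum: "(abs_mat (V * H2_mat p m n X Y) *\<^sub>v abs_vec ?t) $ i
      = (\<Sum>k\<leftarrow>[1..<Suc p]. (abs_mat (V * H2_cols p m n X Y k) *\<^sub>v abs_vec (data_block A B C D E F k)) $ i)"
    if i: "i < N" for i
  proof -
    have "abs_mat (V * H2_cols p m n X Y k)
        \<in> carrier_mat N (dim_vec (abs_vec (data_block A B C D E F k)))" if "k \<in> {1..p}" for k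
      using mult_carrier_mat[OF V H2_cols_carrier[OF XY that, folded N_def]] dim_data_block[OF c that]
      by (simp add: abs_mat_def abs_vec_def)
    then show ?thesis
      unfolding \<open>abs_mat (V * H2_mat p m n X Y) = _\<close> \<open>abs_vec ?t = _\<close>
      by (intro hcat_mult_vcat_index i) (auto simp del: upt_Suc)
  qed
  have "(abs_mat (V * H2_mat p m n X Y) *\<^sub>v abs_vec ?t) $ i = omega p m n A B C D E F X Y $ i"
    if i: "i < N" for i
  proof -
    have "(abs_mat (V * H2_mat p m n X Y) *\<^sub>v abs_vec ?t) $ i
        = (\<Sum>k\<in>{1..p}. (abs_mat (V * H2_cols p m n X Y k) *\<^sub>v abs_vec (data_block A B C D E F k)) $ i)"
      unfolding block_sum[OF i] by (rule sum_list_indices)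
    also have "\<dots> = (\<Sum>k\<in>{1..p}. \<theta> k $ i)" by (rule sum.cong[OF refl cols[OF _ i]])
    also have "\<dots> = omega p m n A B C D E F X Y $ i"
      by (simp only: om index_finsum_vec[OF finite_atLeastAtMost i \<theta>])
    finally show ?thesis .
  qed
  moreover have "omega p m n A B C D E F X Y \<in> carrier_vec N"
    unfolding om by (rule finsum_vec_closed[OF \<theta>])
  ultimately show ?thesis
    unfolding V_def[symmetric] using V by (intro eq_vecI) (auto simp: abs_mat_def)
qed

section \<open>Perturbation of the data\<close>

text \<open>Relative error entry by entry, with the reference on the right. Sign change,
  transposition and Kronecker products with a fixed factor preserve it with the same
  \<open>\<epsilon>\<close>, and these build the blocks of \<open>W\<close>; sums could destroy it
  by cancellation.\<close>

definition near_mat :: "real \<Rightarrow> real mat \<Rightarrow> real mat \<Rightarrow> bool" where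
  "near_mat \<epsilon> M M' \<longleftrightarrow> dim_row M = dim_row M' \<and> dim_col M = dim_col M' \<and>
    (\<forall>i<dim_row M'. \<forall>j<dim_col M'. \<bar>M $$ (i, j) - M' $$ (i, j)\<bar> \<le> \<epsilon> * \<bar>M' $$ (i, j)\<bar>)"

lemma near_mat_refl: "0 < \<epsilon> \<Longrightarrow> near_mat \<epsilon> M M"
  by (simp add: near_mat_def)

lemma near_mat_uminus: "near_mat \<epsilon> M M' \<Longrightarrow> near_mat \<epsilon> (- M) (- M')"
  by (auto simp: near_mat_def abs_minus_commute)

lemma near_mat_transpose: "near_mat \<epsilon> M M' \<Longrightarrow> near_mat \<epsilon> (transpose_mat M) (transpose_mat M')"
  by (auto simp: near_mat_def)

lemma near_mat_kron_right: "near_mat \<epsilon> M M' \<Longrightarrow> near_mat \<epsilon> (T \<otimes>\<^sub>K M) (T \<otimes>\<^sub>K M')"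
  unfolding near_mat_def
proof (elim conjE, intro conjI allI impI)
  fix i j
  assume d: "dim_row M = dim_row M'" "dim_col M = dim_col M'"
    and near: "\<forall>i<dim_row M'. \<forall>j<dim_col M'. \<bar>M $$ (i, j) - M' $$ (i, j)\<bar> \<le> \<epsilon> * \<bar>M' $$ (i, j)\<bar>"
    and "i < dim_row (T \<otimes>\<^sub>K M')" "j < dim_col (T \<otimes>\<^sub>K M')"
  then have ij: "i < dim_row T * dim_row M'" "j < dim_col T * dim_col M'" by simp_all
  then have "i mod dim_row M' < dim_row M'" "j mod dim_col M' < dim_col M'"
    using mod_div_less_mult(1)[of i "dim_row M'" "dim_row T"]
      mod_div_less_mult(1)[of j "dim_col M'" "dim_col T"] by (simp_all add: mult.commute)
  then have "\<bar>M $$ (i mod dim_row M', j mod dim_col M') - M' $$ (i mod dim_row M', j mod dim_col M')\<bar>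
      \<le> \<epsilon> * \<bar>M' $$ (i mod dim_row M', j mod dim_col M')\<bar>" using near by blast
  from mult_left_mono[OF this, of "\<bar>T $$ (i div dim_row M', j div dim_col M')\<bar>"]
  show "\<bar>(T \<otimes>\<^sub>K M) $$ (i, j) - (T \<otimes>\<^sub>K M') $$ (i, j)\<bar> \<le> \<epsilon> * \<bar>(T \<otimes>\<^sub>K M') $$ (i, j)\<bar>"
    using ij d by (simp add: kron_def abs_mult[symmetric] right_diff_distrib mult_ac)
qed simp_all

lemma near_mat_kron_left: "near_mat \<epsilon> M M' \<Longrightarrow> near_mat \<epsilon> (M \<otimes>\<^sub>K T) (M' \<otimes>\<^sub>K T)"
  unfolding near_mat_def
proof (elim conjE, intro conjI allI impI)
  fix i j
  assume d: "dim_row M = dim_row M'" "dim_col M = dim_col M'"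
    and near: "\<forall>i<dim_row M'. \<forall>j<dim_col M'. \<bar>M $$ (i, j) - M' $$ (i, j)\<bar> \<le> \<epsilon> * \<bar>M' $$ (i, j)\<bar>"
    and "i < dim_row (M' \<otimes>\<^sub>K T)" "j < dim_col (M' \<otimes>\<^sub>K T)"
  then have ij: "i < dim_row M' * dim_row T" "j < dim_col M' * dim_col T" by simp_all
  then have "i div dim_row T < dim_row M'" "j div dim_col T < dim_col M'"
    by (simp_all add: less_mult_imp_div_less)
  then have "\<bar>M $$ (i div dim_row T, j div dim_col T) - M' $$ (i div dim_row T, j div dim_col T)\<bar>
      \<le> \<epsilon> * \<bar>M' $$ (i div dim_row T, j div dim_col T)\<bar>" using near by blast
  from mult_right_mono[OF this, of "\<bar>T $$ (i mod dim_row T, j mod dim_col T)\<bar>"]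
  have "\<bar>(M $$ (i div dim_row T, j div dim_col T) - M' $$ (i div dim_row T, j div dim_col T))
      * T $$ (i mod dim_row T, j mod dim_col T)\<bar>
      \<le> \<epsilon> * \<bar>M' $$ (i div dim_row T, j div dim_col T) * T $$ (i mod dim_row T, j mod dim_col T)\<bar>"
    by (simp add: abs_mult mult.assoc)
  then show "\<bar>(M \<otimes>\<^sub>K T) $$ (i, j) - (M' \<otimes>\<^sub>K T) $$ (i, j)\<bar> \<le> \<epsilon> * \<bar>(M' \<otimes>\<^sub>K T) $$ (i, j)\<bar>"
    using ij d by (simp add: kron_def left_diff_distrib)
qed simp_all

lemma near_mat_W_mat:
  assumes "0 < \<epsilon>"
    and near: "\<And>k. k \<in> {1..p} \<Longrightarrow> near_mat \<epsilon> (A k) (A' k) \<and> near_mat \<epsilon> (B k) (B' k) \<and>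
      near_mat \<epsilon> (C k) (C' k) \<and> near_mat \<epsilon> (D k) (D' k)"
    and c: "pgcs_coeffs p m n A' B' C' D' E F"
  shows "near_mat \<epsilon> (W_mat p m n A B C D) (W_mat p m n A' B' C' D')"
  unfolding near_mat_def
proof (intro conjI allI impI)
  fix i j assume "i < dim_row (W_mat p m n A' B' C' D')" "j < dim_col (W_mat p m n A' B' C' D')"
  then have ij: "i < 2 * p * m * n" "j < 2 * p * m * n" by (simp_all add: W_mat_def)
  then have ij': "i < (m * n) * (2 * p)" "j < (m * n) * (2 * p)" by (simp_all add: mult_ac)
  define r where "r = i div (m * n) + 1"
  have r: "(r + 1) div 2 \<in> {1..p}" using mod_div_less_mult(2)[OF ij'(1)] by (auto simp: r_def)
  let ?U = "W_block p m n A B C D r (j div (m * n) + 1)"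
    and ?U' = "W_block p m n A' B' C' D' r (j div (m * n) + 1)"
  \<comment> \<open>Only coefficients of the single index \<open>(r + 1) div 2\<close> occur in
    block row \<open>r\<close>; zero blocks are compared by reflexivity.\<close>
  have "near_mat \<epsilon> ?U ?U'"
    using near[OF r] \<open>0 < \<epsilon>\<close>
    by (auto simp: W_block_def Let_def intro!: near_mat_refl near_mat_uminus near_mat_kron_left
        near_mat_kron_right near_mat_transpose)
  moreover have "?U' \<in> carrier_mat (m * n) (m * n)"
    unfolding r_def by (rule W_block_carrier[OF c mod_div_less_mult(2)[OF ij'(1)]])
  then have "dim_row ?U' = m * n" "dim_col ?U' = m * n" by (rule carrier_matD)+
  ultimately have "\<bar>?U $$ (i mod (m * n), j mod (m * n)) - ?U' $$ (i mod (m * n), j mod (m * n))\<bar>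
      \<le> \<epsilon> * \<bar>?U' $$ (i mod (m * n), j mod (m * n))\<bar>"
    using mod_div_less_mult(1)[OF ij'(1)] mod_div_less_mult(1)[OF ij'(2)] by (simp only: near_mat_def)
  then show "\<bar>W_mat p m n A B C D $$ (i, j) - W_mat p m n A' B' C' D' $$ (i, j)\<bar>
      \<le> \<epsilon> * \<bar>W_mat p m n A' B' C' D' $$ (i, j)\<bar>"
    using ij by (simp add: W_mat_def r_def)
qed (simp_all add: W_mat_def)

lemma read_index_less:
  assumes k: "k \<in> {1..p}" and off: "off + r * c \<le> block_dim m n" and ij: "i < r" "j < c"
  shows "(k - 1) * block_dim m n + (off + (j * r + i)) < p * block_dim m n"
proof -
  have "off + (j * r + i) < block_dim m n" using col_major_less[OF ij] off by simp
  then have "(k - 1) * block_dim m n + (off + (j * r + i)) < Suc (k - 1) * block_dim m n" by simp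
  also have "\<dots> \<le> p * block_dim m n" using k by (intro mult_le_mono1) simp
  finally show ?thesis .
qed

lemma read_mat_zero:
  assumes "k \<in> {1..p}" "off + r * c \<le> block_dim m n"
  shows "read_mat m n r c off (0\<^sub>v (p * block_dim m n)) k = 0\<^sub>m r c"
  using read_index_less[OF assms] by (intro eq_matI) (auto simp: read_mat_def)

lemma near_mat_read_mat:
  assumes x: "x \<in> B0 a \<epsilon>" and a: "a \<in> carrier_vec (p * block_dim m n)" and k: "k \<in> {1..p}"
    and off: "off + r * c \<le> block_dim m n"
  shows "near_mat \<epsilon> (read_mat m n r c off x k) (read_mat m n r c off a k)"
  unfolding near_mat_def
proof (intro conjI allI impI)
  fix i j assume "i < dim_row (read_mat m n r c off a k)" "j < dim_col (read_mat m n r c off a k)"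
  then have ij: "i < r" "j < c" by simp_all
  then have "(k - 1) * block_dim m n + (off + (j * r + i)) < dim_vec a"
    using read_index_less[OF k off] a by simp
  then show "\<bar>read_mat m n r c off x k $$ (i, j) - read_mat m n r c off a k $$ (i, j)\<bar>
      \<le> \<epsilon> * \<bar>read_mat m n r c off a k $$ (i, j)\<bar>"
    using x ij by (simp add: B0_def read_mat_def)
qed simp_all

section \<open>The solution map\<close>

text \<open>Total functions of the data vector, this one and \<open>rhs_of\<close>, take the place
  of the existentially quantified coefficients in the domain and in \<open>\<Psi>\<close>.\<close>

definition W_of :: "nat \<Rightarrow> nat \<Rightarrow> nat \<Rightarrow> real vec \<Rightarrow> real mat" where
  "W_of p m n x = W_mat p m n (coeff_A m n x) (coeff_B m n x) (coeff_C m n x) (coeff_D m n x)"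

definition rhs_of :: "nat \<Rightarrow> nat \<Rightarrow> nat \<Rightarrow> real vec \<Rightarrow> real vec" where
  "rhs_of p m n x = stack_cols (interleave p m (coeff_E m n x) (coeff_F m n x))"

lemma W_of_carrier: "W_of p m n x \<in> carrier_mat (2 * p * m * n) (2 * p * m * n)"
  by (simp add: W_of_def W_mat_carrier)

lemma rhs_of_carrier: "rhs_of p m n x \<in> carrier_vec (2 * p * m * n)"
proof -
  have "interleave p m (coeff_E m n x) (coeff_F m n x) \<in> carrier_mat m (2 * p * n)"
    by (rule interleave_carrier) simp
  from stack_cols_carrier[OF this] show ?thesis by (simp add: rhs_of_def mult_ac)
qed

lemma W_of_data_vec:
  assumes c: "pgcs_coeffs p m n A B C D E F"
  shows "W_of p m n (data_vec p A B C D E F) = W_mat p m n A B C D"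
  unfolding W_of_def by (rule W_mat_cong) (simp add: read_mat_data_vec[OF c])

lemma rhs_of_data_vec:
  assumes c: "pgcs_coeffs p m n A B C D E F"
  shows "rhs_of p m n (data_vec p A B C D E F) = stack_cols (interleave p m E F)"
  unfolding rhs_of_def
  by (rule arg_cong[of _ _ stack_cols], rule interleave_cong) (simp add: read_mat_data_vec[OF c])

lemma H2_mat_mult_eq:
  assumes XY: "\<forall>k\<in>{1..p}. X k \<in> carrier_mat m n \<and> Y k \<in> carrier_mat m n"
    and x: "x \<in> carrier_vec (p * block_dim m n)"
  shows "H2_mat p m n X Y *\<^sub>v x = W_of p m n x *\<^sub>v stack_cols (interleave p m X Y) - rhs_of p m n x"
  using H2_mat_mult_data_vec[OF pgcs_coeffs_read_mat[of p m n x] XY]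
  by (simp only: data_vec_read_mat[OF x] W_of_def rhs_of_def)

text \<open>One direction rests on the injectivity of \<open>data_vec\<close>, the other on its
  surjectivity.\<close>

lemma Dom_Psi_iff:
  "x \<in> Dom\<^sub>\<Psi> p m n \<longleftrightarrow> x \<in> carrier_vec (p * block_dim m n) \<and> invertible_mat (W_of p m n x)"
proof
  assume "x \<in> Dom\<^sub>\<Psi> p m n"
  then obtain A B C D E F where c: "pgcs_coeffs p m n A B C D E F" and x: "x = data_vec p A B C D E F"
    and "invertible_mat (W_mat p m n A B C D)" by (auto simp: Dom_Psi_def)
  then show "x \<in> carrier_vec (p * block_dim m n) \<and> invertible_mat (W_of p m n x)"
    using dim_data_vec[OF c] by (auto simp: W_of_data_vec[OF c] intro!: carrier_vecI)
next
  assume x: "x \<in> carrier_vec (p * block_dim m n) \<and> invertible_mat (W_of p m n x)"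
  then have "x = data_vec p (coeff_A m n x) (coeff_B m n x) (coeff_C m n x) (coeff_D m n x)
      (coeff_E m n x) (coeff_F m n x)" using data_vec_read_mat by simp
  then show "x \<in> Dom\<^sub>\<Psi> p m n"
    using x pgcs_coeffs_read_mat[of p m n x] unfolding Dom_Psi_def W_of_def by blast
qed

lemma Psi_equation:
  assumes x: "x \<in> Dom\<^sub>\<Psi> p m n"
  shows "\<Psi> p m n x \<in> carrier_vec (2 * p * m * n)" "W_of p m n x *\<^sub>v \<Psi> p m n x = rhs_of p m n x"
    and "\<And>z. z \<in> carrier_vec (2 * p * m * n) \<Longrightarrow> W_of p m n x *\<^sub>v z = rhs_of p m n x \<Longrightarrow> \<Psi> p m n x = z"
proof -
  have xc: "x \<in> carrier_vec (p * block_dim m n)" and inv: "invertible_mat (W_of p m n x)"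
    using x by (simp_all add: Dom_Psi_iff)
  define N where "N = 2 * p * m * n"
  define V where "V = inv_mat (W_of p m n x)"
  have W: "W_of p m n x \<in> carrier_mat N N" and g: "rhs_of p m n x \<in> carrier_vec N"
    using W_of_carrier rhs_of_carrier by (simp_all add: N_def)
  note V = inv_mat_inverts[OF W inv, folded V_def]
  \<comment> \<open>All families that represent \<open>x\<close> have the same \<open>W\<close> and
    the same right-hand side, so the quantifiers in the description of \<open>\<Psi>\<close>
    disappear and a single linear system remains.\<close>
  have sol: "(\<exists>A B C D E F. pgcs_coeffs p m n A B C D E F \<and> x = data_vec p A B C D E F \<and>
        W_mat p m n A B C D *\<^sub>v z = stack_cols (interleave p m E F))
      \<longleftrightarrow> W_of p m n x *\<^sub>v z = rhs_of p m n x" for z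
  proof
    assume "\<exists>A B C D E F. pgcs_coeffs p m n A B C D E F \<and> x = data_vec p A B C D E F \<and>
        W_mat p m n A B C D *\<^sub>v z = stack_cols (interleave p m E F)"
    then show "W_of p m n x *\<^sub>v z = rhs_of p m n x"
      using W_of_data_vec rhs_of_data_vec by metis
  next
    assume "W_of p m n x *\<^sub>v z = rhs_of p m n x"
    then show "\<exists>A B C D E F. pgcs_coeffs p m n A B C D E F \<and> x = data_vec p A B C D E F \<and>
        W_mat p m n A B C D *\<^sub>v z = stack_cols (interleave p m E F)"
      using pgcs_coeffs_read_mat[of p m n x] data_vec_read_mat[OF xc, symmetric]
      unfolding W_of_def rhs_of_def by blast
  qed
  have uniq: "z = V *\<^sub>v rhs_of p m n x" if z: "z \<in> carrier_vec N" and e: "W_of p m n x *\<^sub>v z = rhs_of p m n x" for z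
  proof -
    have "V *\<^sub>v rhs_of p m n x = (V * W_of p m n x) *\<^sub>v z" using V(1) W z e by simp
    then show ?thesis using V(2) z by simp
  qed
  have ex: "V *\<^sub>v rhs_of p m n x \<in> carrier_vec N" "W_of p m n x *\<^sub>v (V *\<^sub>v rhs_of p m n x) = rhs_of p m n x"
  proof -
    show "V *\<^sub>v rhs_of p m n x \<in> carrier_vec N" using V(1) g by simp
    have "W_of p m n x *\<^sub>v (V *\<^sub>v rhs_of p m n x) = (W_of p m n x * V) *\<^sub>v rhs_of p m n x"
      using V(1) W g by simp
    then show "W_of p m n x *\<^sub>v (V *\<^sub>v rhs_of p m n x) = rhs_of p m n x" using V(3) g by simp
  qed
  have Psi: "\<Psi> p m n x = V *\<^sub>v rhs_of p m n x"
    unfolding Psi_def sol N_def[symmetric] using uniq ex by (intro the_equality) blast+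
  show "\<Psi> p m n x \<in> carrier_vec (2 * p * m * n)" "W_of p m n x *\<^sub>v \<Psi> p m n x = rhs_of p m n x"
    using ex by (simp_all add: Psi N_def)
  show "\<Psi> p m n x = z" if "z \<in> carrier_vec (2 * p * m * n)" "W_of p m n x *\<^sub>v z = rhs_of p m n x" for z
    unfolding Psi using uniq[of z] that by (simp add: N_def)
qed

theorem theorem5p1:
  fixes p m n :: nat
    and A B C D E F X Y :: "nat \<Rightarrow> real mat"
    and W H\<^sub>2 Z :: "real mat" and t \<omega> :: "real vec"
  assumes "p \<ge> 1" and "m \<ge> 1" and "n \<ge> 1"
    and "pgcs_coeffs p m n A B C D E F"
    and "t = data_vec p A B C D E F"
    and "W = W_mat p m n A B C D"
    and "invertible_mat W"
    and "\<And>k. k \<in> {1..p} \<Longrightarrow> X k \<in> carrier_mat m n \<and> Y k \<in> carrier_mat m n"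
    and "pgcs_equation p A B C D E F X Y"
    and "Z = interleave p m X Y"
    and "Z \<noteq> 0\<^sub>m m (2 * p * n)"
    and "H\<^sub>2 = H2_mat p m n X Y"
    and "\<omega> = omega p m n A B C D E F X Y"
  shows "mixed_cond (Dom\<^sub>\<Psi> p m n) (\<Psi> p m n) t
           = ereal (norm_inf (abs_mat (inv_mat W * H\<^sub>2) *\<^sub>v abs_vec t) / norm_max Z)
       \<and> norm_inf (abs_mat (inv_mat W * H\<^sub>2) *\<^sub>v abs_vec t) / norm_max Z
           = norm_inf \<omega> / norm_max Z
       \<and> comp_cond (Dom\<^sub>\<Psi> p m n) (\<Psi> p m n) t
           = ereal (norm_inf (entry_div (abs_mat (inv_mat W * H\<^sub>2) *\<^sub>v abs_vec t) (stack_cols Z)))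
       \<and> norm_inf (entry_div (abs_mat (inv_mat W * H\<^sub>2) *\<^sub>v abs_vec t) (stack_cols Z))
           = norm_inf (entry_div \<omega> (stack_cols Z))"
proof -
  note c = assms(4) and t = assms(5) and W = assms(6) and inv = assms(7) and Z = assms(10)
    and H\<^sub>2 = assms(12) and \<omega> = assms(13)
  have XY: "\<forall>k\<in>{1..p}. X k \<in> carrier_mat m n \<and> Y k \<in> carrier_mat m n" using assms(8) by blast
  define N where "N = 2 * p * m * n"
  define z where "z = stack_cols Z"
  define V where "V = inv_mat W"
  define \<theta> where "\<theta> = abs_mat (V * H\<^sub>2) *\<^sub>v abs_vec t"
  have N: "0 < N" using assms(1-3) by (simp add: N_def)
  have tc: "t \<in> carrier_vec (p * block_dim m n)"
    unfolding t by (rule carrier_vecI[OF dim_data_vec[OF c]])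
  have Wt: "W_of p m n t = W" unfolding t W by (rule W_of_data_vec[OF c])
  have Wc: "W \<in> carrier_mat N N" by (simp add: W N_def W_mat_carrier)
  note V = inv_mat_inverts[OF Wc inv, folded V_def]
  have Hc: "H\<^sub>2 \<in> carrier_mat N (dim_vec t)"
    using H2_mat_eq_hcat(2)[OF XY] tc by (simp add: H\<^sub>2 N_def)
  have tD: "t \<in> Dom\<^sub>\<Psi> p m n" using tc inv by (simp add: Dom_Psi_iff Wt)
  have Zc: "Z \<in> carrier_mat m (2 * p * n)" unfolding Z by (rule interleave_carrier[OF XY])
  have zc: "z \<in> carrier_vec N" using stack_cols_carrier[OF Zc] by (simp add: z_def N_def mult_ac)

  have "W *\<^sub>v z = stack_cols (interleave p m (\<lambda>k. A k * X k - Y k * B k)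
      (\<lambda>k. C k * X (k mod p + 1) - Y k * D k))"
    unfolding W z_def Z by (rule W_mat_mult_stack_cols[OF c XY])
  also have "\<dots> = stack_cols (interleave p m E F)"
    by (rule arg_cong[of _ _ stack_cols], rule interleave_cong)
      (use assms(9) in \<open>auto simp: pgcs_equation_def\<close>)
  also have "\<dots> = rhs_of p m n t" unfolding t by (rule rhs_of_data_vec[OF c, symmetric])
  finally have Wz: "W *\<^sub>v z = rhs_of p m n t" .
  have Psi_t: "\<Psi> p m n t = z"
    by (rule Psi_equation(3)[OF tD]) (use zc Wz in \<open>simp_all add: Wt N_def\<close>)

  have z0: "z \<noteq> 0\<^sub>v N"
  proof
    assume z: "z = 0\<^sub>v N"
    have "Z = 0\<^sub>m m (2 * p * n)"
    proof (rule eq_matI)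
      fix i j assume "i < dim_row (0\<^sub>m m (2 * p * n))" "j < dim_col (0\<^sub>m m (2 * p * n))"
      then have ij: "i < m" "j < 2 * p * n" by simp_all
      have "Z $$ (i, j) = z $ (j * m + i)"
        unfolding z_def by (rule stack_cols_col_major_index[OF Zc ij, symmetric])
      also have "\<dots> = 0" using z col_major_less[OF ij] by (simp add: N_def mult_ac)
      finally show "Z $$ (i, j) = 0\<^sub>m m (2 * p * n) $$ (i, j)" using ij by simp
    qed (use Zc in auto)
    then show False using assms(11) by contradiction
  qed
  have z_pos: "0 < norm_inf z" using norm_inf_pos[of z] z0 zc by simp

  \<comment> \<open>If \<open>t = 0\<close>, then the right-hand side vanishes, and so does the solution \<open>z\<close>.\<close>
  have t0: "t \<noteq> 0\<^sub>v (dim_vec t)"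
  proof
    assume t0: "t = 0\<^sub>v (dim_vec t)"
    have rhs0: "rhs_of p m n t = 0\<^sub>v N"
    proof (rule eq_vecI)
      fix i assume "i < dim_vec (0\<^sub>v N)"
      then have i: "i < 2 * p * m * n" by (simp add: N_def)
      have i': "i < (m * n) * (2 * p)" using i by (simp add: mult_ac)
      have EF: "\<forall>k\<in>{1..p}. coeff_E m n t k \<in> carrier_mat m n \<and> coeff_F m n t k \<in> carrier_mat m n"
        by simp
      define k where "k = i div (m * n) div 2 + 1"
      have k: "k \<in> {1..p}" using mod_div_less_mult(2)[OF i'] by (auto simp: k_def)
      have "t = 0\<^sub>v (p * block_dim m n)" using t0 tc by simp
      then have "coeff_E m n t k = 0\<^sub>m m n" "coeff_F m n t k = 0\<^sub>m m n"
        using read_mat_zero[OF k] by (simp_all add: block_dim_def)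
      then have "(if even (i div (m * n)) then coeff_E m n t else coeff_F m n t) k = 0\<^sub>m m n"
        by simp
      then have "rhs_of p m n t $ i = stack_cols (0\<^sub>m m n) $ (i mod (m * n))"
        unfolding rhs_of_def stack_cols_interleave_index[OF EF i] k_def[symmetric] by simp
      also have "\<dots> = 0"
        using mod_div_less_mult[OF mod_div_less_mult(1)[OF i']] mod_div_less_mult(1)[OF i']
        by (simp add: stack_cols_index)
      finally show "rhs_of p m n t $ i = 0\<^sub>v N $ i" using i by (simp add: N_def)
    qed (use rhs_of_carrier[of p m n t] in \<open>simp add: N_def\<close>)
    have "z = (V * W) *\<^sub>v z" using V(2) zc by simp
    also have "\<dots> = V *\<^sub>v rhs_of p m n t" using V(1) Wc zc Wz by simp
    also have "\<dots> = 0\<^sub>v N" using V(1) by (auto simp: rhs0 intro!: eq_vecI)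
    finally show False using z0 by contradiction
  qed

  \<comment> \<open>\<open>H\<^sub>2\<close> is built from the unperturbed solution. Its product
    with \<open>x\<close> is the residual of \<open>z\<close> for the data \<open>x\<close>; its
    product with \<open>t\<close> is zero because \<open>z\<close> solves that equation, so
    \<open>x\<close> may be replaced by \<open>x - t\<close>.\<close>
  have diff: "\<Psi> p m n x - \<Psi> p m n t \<in> carrier_vec N \<and>
      W_of p m n x *\<^sub>v (\<Psi> p m n x - \<Psi> p m n t) = - (H\<^sub>2 *\<^sub>v (x - t))"
    if xD: "x \<in> Dom\<^sub>\<Psi> p m n" and "x \<in> carrier_vec (dim_vec t)" for x
  proof -
    have xc: "x \<in> carrier_vec (p * block_dim m n)" using xD by (simp add: Dom_Psi_iff)
    note Px = Psi_equation(1,2)[OF xD, folded N_def]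
    have Wx: "W_of p m n x \<in> carrier_mat N N" by (simp add: N_def W_of_carrier)
    have g: "rhs_of p m n x \<in> carrier_vec N" by (simp add: N_def rhs_of_carrier)
    have Hx: "H\<^sub>2 *\<^sub>v x = W_of p m n x *\<^sub>v z - rhs_of p m n x"
      unfolding H\<^sub>2 z_def Z by (rule H2_mat_mult_eq[OF XY xc])
    have Ht: "H\<^sub>2 *\<^sub>v t = 0\<^sub>v N"
      using H2_mat_mult_eq[OF XY tc] Wz Wc rhs_of_carrier[of p m n t]
      by (simp add: H\<^sub>2[symmetric] Wt z_def[symmetric] Z[symmetric] N_def)
    have "W_of p m n x *\<^sub>v (\<Psi> p m n x - z) = rhs_of p m n x - W_of p m n x *\<^sub>v z"
      using Px zc by (simp add: mult_minus_distrib_mat_vec[OF Wx])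
    also have "\<dots> = - (H\<^sub>2 *\<^sub>v x)" using g Wx zc by (intro eq_vecI) (auto simp: Hx)
    also have "H\<^sub>2 *\<^sub>v x = H\<^sub>2 *\<^sub>v (x - t)"
      using Hc tc xc by (subst mult_minus_distrib_mat_vec[OF Hc]) (auto simp: Ht intro!: eq_vecI)
    finally show ?thesis using Px(1) zc by (simp add: Psi_t)
  qed

  have near: "\<bar>(W_of p m n x - W) $$ (i, j)\<bar> \<le> \<epsilon> * \<bar>W $$ (i, j)\<bar>"
    if "0 < \<epsilon>" "x \<in> B0 t \<epsilon>" "i < N" "j < N" for x \<epsilon> i j
  proof -
    \<comment> \<open>Reading off a coefficient merely copies entries of the data vector, so the
      bounds defining \<open>B0\<close> carry over to the coefficients and from there to
      \<open>W\<close>.\<close>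
    have "near_mat \<epsilon> (W_of p m n x) (W_of p m n t)"
      unfolding W_of_def
      by (rule near_mat_W_mat[OF \<open>0 < \<epsilon>\<close> _ pgcs_coeffs_read_mat[of p m n t]], intro conjI;
          rule near_mat_read_mat[OF \<open>x \<in> B0 t \<epsilon>\<close> tc]) (auto simp: block_dim_def)
    then show ?thesis using that Wc by (simp add: Wt near_mat_def)
  qed

  have limit: "Lim (at_right 0) (\<lambda>\<epsilon>. SUP x \<in> {x \<in> B0 t \<epsilon> \<inter> Dom\<^sub>\<Psi> p m n. x \<noteq> t}.
       ereal (norm_inf (vec N (\<lambda>i. w i * (\<Psi> p m n x - \<Psi> p m n t) $ i)) / cdist x t))
     = ereal (norm_inf (vec N (\<lambda>i. w i * \<theta> $ i)))" for w
    unfolding \<theta>_def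
    by (rule weighted_condition_limit[OF N t0 V(1) Hc Wc V(2), of "W_of p m n"])
      (use near diff W_of_carrier tc in \<open>auto simp: N_def Dom_Psi_iff\<close>)

  have \<theta>c: "\<theta> \<in> carrier_vec N" using V(1) by (simp add: \<theta>_def abs_mat_def carrier_vecI)
  have scaled: "norm_inf (vec N (\<lambda>i. 1 / norm_inf z * v $ i)) = norm_inf v / norm_inf z"
    if v: "v \<in> carrier_vec N" for v
  proof -
    have "vec N (\<lambda>i. 1 / norm_inf z * v $ i) = (1 / norm_inf z) \<cdot>\<^sub>v v"
      using v by (intro eq_vecI) auto
    then show ?thesis using z_pos by (simp add: norm_inf_smult)
  qed
  have divided: "entry_div v z = vec N (\<lambda>i. (if z $ i \<noteq> 0 then 1 / z $ i else 1) * v $ i)" for v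
    using zc by (intro eq_vecI) (auto simp: entry_div_def)

  have "mixed_cond (Dom\<^sub>\<Psi> p m n) (\<Psi> p m n) t = ereal (norm_inf \<theta> / norm_inf z)"
  proof -
    have "norm_inf (\<Psi> p m n x - \<Psi> p m n t) / norm_inf (\<Psi> p m n t) * (1 / cdist x t)
        = norm_inf (vec N (\<lambda>i. 1 / norm_inf z * (\<Psi> p m n x - \<Psi> p m n t) $ i)) / cdist x t"
      if "x \<in> {x \<in> B0 t \<epsilon> \<inter> Dom\<^sub>\<Psi> p m n. x \<noteq> t}" for x \<epsilon>
      using that scaled diff by (simp add: Psi_t B0_def)
    then show ?thesis
      unfolding mixed_cond_def scaled[OF \<theta>c, symmetric] limit[of "\<lambda>_. 1 / norm_inf z", symmetric]
      by (intro arg_cong[of _ _ "Lim (at_right 0)"] ext SUP_cong refl arg_cong[of _ _ ereal])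
  qed
  moreover have "comp_cond (Dom\<^sub>\<Psi> p m n) (\<Psi> p m n) t = ereal (norm_inf (entry_div \<theta> z))"
    unfolding comp_cond_def cdist_def[of "\<Psi> p m n _"] Psi_t divided
    using limit by (simp add: Psi_t)
  moreover have "\<omega> = \<theta>"
    unfolding \<omega> \<theta>_def V_def W H\<^sub>2 t by (rule omega_eq[OF c XY inv[unfolded W]])
  ultimately show ?thesis
    by (simp add: \<theta>_def V_def z_def norm_max_def)
qed

end
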